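(* Let $\tau:\{0,1\}\to\{0,1\}^+$ be a one-to-one primitive substitution of constant length $p\ge2$ such that $X_\tau$ is not finite. Consider $\{x,y\}\subseteq X_\tau$ such that $\pi(x)=\pi(y)$. Then: (1) If $\tau(0)$ and $\tau(1)$ have no coincidence, then $\{x,y\}$ is distal whenever there is $i\in\mathbb N$ such that $x_i\ne y_i$ and $|\mathcal I^+(T^i(x))|=|\mathcal I^+(T^i(y))|=\infty$. In any other case the pair is asymptotic. (2) If there exists a unique non-coincidence of $\tau(0)$ and $\tau(1)$, then $\{x,y\}$ is asymptotic. (3) There exist Li–Yorke pairs in $(X_\tau,T)$ if and only if $\tau(0)$ and $\tau(1)$ have coincidences and at least two non-coincidences. Moreover, $(x,y)$ is a Li–Yorke pair if and only if for infinitely many $i\in\mathbb N$: $s_i(x)\neq s_i(y)$, if $|\mathcal I^+(x)|=\infty$; or $s_i(T^{k^+(x)}(x))\ne s_i(T^{k^+(y)}(y))$, if $|\mathcal I^+(x)|<\infty$.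
   Context: $\mathbb N$ is the set of non-negative integers. A substitution is a map $\tau:A\to A^+$, where $A$ is a finite set (here $A=\{0,1\}$) and $A^+$ is the set of non-empty finite words over $A$; it is extended to $A^+$ and $A^{\mathbb Z}$ by concatenation (on $A^{\mathbb Z}$, $\tau(x)=\dots\tau(x_{-1}).\tau(x_0)\tau(x_1)\dots$, the dot preceding coordinate $0$). It has constant length $p$ if $|\tau(a)|=p$ for all $a\in A$, is one-to-one if $\tau(a)\neq\tau(b)$ for $a\ne b$ in $A$, and is primitive if there is $n$ such that $a$ appears in $\tau^n(b)$ for all $a,b\in A$. The shift is $T((x_i)_i)=(x_{i+1})_i$. $X_\tau$ is the smallest subshift (closed shift-invariant subset) of $A^{\mathbb Z}$ in which all words $\tau^n(a)$, $n\in\mathbb N$, $a\in A$, appear; fix a metric $\varrho$ compatible with its topology. Pairs: $\{x,y\}$ is distal if $\liminf_{n\to\infty}\varrho(T^nx,T^ny)>0$, proximal if this $\liminf$ is $0$, asymptotic if $\lim_{n\to\infty}\varrho(T^nx,T^ny)=0$, and Li–Yorke if it is proximal but not asymptotic. For two words $u,u'$ of the same length, a coincidence is a coordinate $i$ with $u_i=u'_i$; a non-coincidence is a coordinate $i$ with $u_i\ne u'_i$. Expansion: by known results (Dekking, Mossé), when $X_\tau$ is infinite, $\tau:X_\tau\to\tau(X_\tau)$ is injective and $\{T^i(\tau(X_\tau)):0\le i\le p-1\}$ is a clopen partition of $X_\tau$. Hence for each $x\in X_\tau$ there are a unique sequence $(x^{(i)})_{i\in\mathbb N}$ in $X_\tau$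 and a unique sequence $(\delta_i)_{i\in\mathbb N}$ in $\{0,\dots,p-1\}$ with $x^{(0)}=x$ and $x^{(i)}=T^{\delta_i}\tau(x^{(i+1)})$ for all $i\ge 0$. Put $\pi(x)=(\delta_i)_{i\in\mathbb N}$. Put $s_i(x)=x^{(i)}_1x^{(i)}_2\cdots x^{(i)}_{p-1-\delta_i}$ (the empty word if $\delta_i=p-1$), and $\mathcal I^+(x)=\{i\in\mathbb N:|s_i(x)|\ne0\}$. Put $k^+(x)=\sup\{|x_0s_0(x)\tau(s_1(x))\cdots\tau^i(s_i(x))|:i\in\mathcal I^+(x)\}$, with $k^+(x)=|x_0|=1$ if $\mathcal I^+(x)=\emptyset$; it is finite exactly when $\mathcal I^+(x)$ is finite. $\mathcal I^+$ and $k^+$ depend only on $\pi(x)$.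
   Formalization: The "Moreover" of (3) is stated only when τ(0) and τ(1) have a coincidence; without one it is false (Thue–Morse, y the complement of x with infinite I^+(x): all nonempty s_i differ, yet the pair is distal). *)

theory Defs
  imports "HOL-Analysis.Analysis"
begin

text \<open>
  Words are lists and elements of \<open>A\<^sup>\<int>\<close> are functions on the integers, with the type \<^typ>\<open>'a\<close>
  as alphabet.  The alphabet \<open>{0,1}\<close> is rendered as \<^typ>\<open>bool\<close>, with \<open>0 = False\<close> and \<open>1 = True\<close>.
\<close>

type_synonym 'a biseq = "int \<Rightarrow> 'a"

section \<open>Substitutions and their subshifts\<close>

definition substitution :: "('a \<Rightarrow> 'a list) \<Rightarrow> bool" where
  "substitution \<tau> \<longleftrightarrow> (\<forall>a. \<tau> a \<noteq> [])"

definition subst_word :: "('a \<Rightarrow> 'a list) \<Rightarrow> 'a list \<Rightarrow> 'a list" where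
  "subst_word \<tau> w = concat (map \<tau> w)"

text \<open>
  The coordinate \<open>i \<ge> 0\<close> of \<open>\<tau>(x)\<close> is read off from \<open>\<tau>(x\<^sub>0 \<dots> x\<^sub>i)\<close>, which starts at coordinate
  \<open>0\<close>; the coordinate \<open>i < 0\<close> is read off from \<open>\<tau>(x\<^sub>i \<dots> x\<^bsub>-1\<^esub>)\<close>, which ends at coordinate
  \<open>-1\<close>.  Both words are long enough because \<open>\<tau>\<close> takes non-empty values.
\<close>

definition subst_seq :: "('a \<Rightarrow> 'a list) \<Rightarrow> 'a biseq \<Rightarrow> 'a biseq" where
  "subst_seq \<tau> x i =
     (if 0 \<le> i then subst_word \<tau> (map x [0..i]) ! nat i
      else (let w = subst_word \<tau> (map x [i..-1]) in w ! (length w - nat (- i))))"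

definition constant_length :: "('a \<Rightarrow> 'a list) \<Rightarrow> nat \<Rightarrow> bool" where
  "constant_length \<tau> p \<longleftrightarrow> (\<forall>a. length (\<tau> a) = p)"

definition primitive_subst :: "('a \<Rightarrow> 'a list) \<Rightarrow> bool" where
  "primitive_subst \<tau> \<longleftrightarrow> (\<exists>n. \<forall>a b. a \<in> set ((subst_word \<tau> ^^ n) [b]))"

definition shift :: "'a biseq \<Rightarrow> 'a biseq" where
  "shift x = (\<lambda>i. x (i + 1))"

definition full_shift_topology :: "'a biseq topology" where
  "full_shift_topology = product_topology (\<lambda>_. discrete_topology UNIV) UNIV"

definition subshift :: "'a biseq set \<Rightarrow> bool" where
  "subshift X \<longleftrightarrow> closedin full_shift_topology X \<and> shift ` X = X"

definition appears_in :: "'a list \<Rightarrow> 'a biseq set \<Rightarrow> bool" where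
  "appears_in w X \<longleftrightarrow> (\<exists>x\<in>X. \<exists>k. \<forall>j<length w. x (k + int j) = w ! j)"

definition subst_shift :: "('a \<Rightarrow> 'a list) \<Rightarrow> 'a biseq set" where
  "subst_shift \<tau> =
     (LEAST X. subshift X \<and> (\<forall>n a. appears_in ((subst_word \<tau> ^^ n) [a]) X))"

section \<open>Pairs of points\<close>

definition compatible_metric :: "'a biseq set \<Rightarrow> ('a biseq \<Rightarrow> 'a biseq \<Rightarrow> real) \<Rightarrow> bool" where
  "compatible_metric X \<rho> \<longleftrightarrow>
     Metric_space X \<rho> \<and>
     Metric_space.mtopology X \<rho> = subtopology full_shift_topology X"

definition dist_liminf :: "('a biseq \<Rightarrow> 'a biseq \<Rightarrow> real) \<Rightarrow> 'a biseq \<Rightarrow> 'a biseq \<Rightarrow> ereal" where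
  "dist_liminf \<rho> x y = liminf (\<lambda>n. ereal (\<rho> ((shift ^^ n) x) ((shift ^^ n) y)))"

definition distal_pair :: "('a biseq \<Rightarrow> 'a biseq \<Rightarrow> real) \<Rightarrow> 'a biseq \<Rightarrow> 'a biseq \<Rightarrow> bool" where
  "distal_pair \<rho> x y \<longleftrightarrow> dist_liminf \<rho> x y > 0"

definition proximal_pair :: "('a biseq \<Rightarrow> 'a biseq \<Rightarrow> real) \<Rightarrow> 'a biseq \<Rightarrow> 'a biseq \<Rightarrow> bool" where
  "proximal_pair \<rho> x y \<longleftrightarrow> dist_liminf \<rho> x y = 0"

definition asymptotic_pair :: "('a biseq \<Rightarrow> 'a biseq \<Rightarrow> real) \<Rightarrow> 'a biseq \<Rightarrow> 'a biseq \<Rightarrow> bool" where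
  "asymptotic_pair \<rho> x y \<longleftrightarrow> (\<lambda>n. \<rho> ((shift ^^ n) x) ((shift ^^ n) y)) \<longlonglongrightarrow> 0"

definition li_yorke_pair :: "('a biseq \<Rightarrow> 'a biseq \<Rightarrow> real) \<Rightarrow> 'a biseq \<Rightarrow> 'a biseq \<Rightarrow> bool" where
  "li_yorke_pair \<rho> x y \<longleftrightarrow> proximal_pair \<rho> x y \<and> \<not> asymptotic_pair \<rho> x y"

section \<open>Coincidences\<close>

text \<open>Only used for words \<open>u\<close>, \<open>v\<close> of the same length.\<close>

definition coincidences :: "'a list \<Rightarrow> 'a list \<Rightarrow> nat set" where
  "coincidences u v = {i. i < length u \<and> u ! i = v ! i}"

definition non_coincidences :: "'a list \<Rightarrow> 'a list \<Rightarrow> nat set" where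
  "non_coincidences u v = {i. i < length u \<and> u ! i \<noteq> v ! i}"

section \<open>Expansions\<close>

text \<open>
  Throughout, \<open>p\<close> is the constant length of \<open>\<tau>\<close>.  Existence and uniqueness of the expansion, on
  which the definite description relies, hold for every point of \<^term>\<open>subst_shift \<tau>\<close> when \<open>\<tau>\<close> is
  one-to-one and primitive and its subshift is infinite.
\<close>

definition is_expansion ::
  "nat \<Rightarrow> ('a \<Rightarrow> 'a list) \<Rightarrow> 'a biseq \<Rightarrow> (nat \<Rightarrow> 'a biseq) \<times> (nat \<Rightarrow> nat) \<Rightarrow> bool" where
  "is_expansion p \<tau> x = (\<lambda>(z, \<delta>).
     z 0 = x \<and>
     (\<forall>i. z i \<in> subst_shift \<tau> \<and> \<delta> i \<in> {0..p - 1} \<and>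
          z i = (shift ^^ \<delta> i) (subst_seq \<tau> (z (Suc i)))))"

definition expansion ::
  "nat \<Rightarrow> ('a \<Rightarrow> 'a list) \<Rightarrow> 'a biseq \<Rightarrow> (nat \<Rightarrow> 'a biseq) \<times> (nat \<Rightarrow> nat)" where
  "expansion p \<tau> x = (THE e. is_expansion p \<tau> x e)"

text \<open>The sequences \<open>(x\<^sup>(\<^sup>i\<^sup>))\<^sub>i\<close> and \<open>\<pi>(x) = (\<delta>\<^sub>i)\<^sub>i\<close>.\<close>

definition desubst :: "nat \<Rightarrow> ('a \<Rightarrow> 'a list) \<Rightarrow> 'a biseq \<Rightarrow> nat \<Rightarrow> 'a biseq" where
  "desubst p \<tau> x = fst (expansion p \<tau> x)"

definition digits :: "nat \<Rightarrow> ('a \<Rightarrow> 'a list) \<Rightarrow> 'a biseq \<Rightarrow> nat \<Rightarrow> nat" where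
  "digits p \<tau> x = snd (expansion p \<tau> x)"

definition right_part :: "nat \<Rightarrow> ('a \<Rightarrow> 'a list) \<Rightarrow> nat \<Rightarrow> 'a biseq \<Rightarrow> 'a list" where
  "right_part p \<tau> i x =
     map (desubst p \<tau> x i) [1..int p - 1 - int (digits p \<tau> x i)]"

definition I_plus :: "nat \<Rightarrow> ('a \<Rightarrow> 'a list) \<Rightarrow> 'a biseq \<Rightarrow> nat set" where
  "I_plus p \<tau> x = {i. length (right_part p \<tau> i x) \<noteq> 0}"

text \<open>The word \<open>x\<^sub>0 s\<^sub>0(x) \<tau>(s\<^sub>1(x)) \<dots> \<tau>\<^sup>i(s\<^sub>i(x))\<close>.\<close>

definition right_word :: "nat \<Rightarrow> ('a \<Rightarrow> 'a list) \<Rightarrow> nat \<Rightarrow> 'a biseq \<Rightarrow> 'a list" where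
  "right_word p \<tau> i x =
     x 0 # concat (map (\<lambda>j. (subst_word \<tau> ^^ j) (right_part p \<tau> j x)) [0..<Suc i])"

definition k_plus :: "nat \<Rightarrow> ('a \<Rightarrow> 'a list) \<Rightarrow> 'a biseq \<Rightarrow> enat" where
  "k_plus p \<tau> x =
     (if I_plus p \<tau> x = {} then 1
      else (SUP i\<in>I_plus p \<tau> x. enat (length (right_word p \<tau> i x))))"

end

theory Submission
  imports Defs "HOL-Library.Sublist"
begin

text \<open>
  Points with the same digits can be compared block by block.
  Let \<open>P\<^sub>i = \<Sum>j<i. \<delta>\<^sub>j p\<^sup>j\<close>.  A point \<open>x\<close> with digits \<open>\<delta>\<close> is cut, for each \<open>i\<close>, into blocks of length
  \<open>p\<^sup>i\<close>: the coordinate \<open>n\<close> lies in the block with index \<open>\<lfloor>(n + P\<^sub>i) / p\<^sup>i\<rfloor>\<close>, and that block is the image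
  under \<open>\<tau>\<^sup>i\<close> of the letter of \<open>x\<^sup>(\<^sup>i\<^sup>)\<close> with the same index.  Two points with the same digits are cut in the
  same way, so comparing them at level \<open>0\<close> amounts to comparing \<open>x\<^sup>(\<^sup>i\<^sup>)\<close> and \<open>y\<^sup>(\<^sup>i\<^sup>)\<close> letter by letter.
  Equal letters give equal blocks, and, as \<open>\<tau>\<close> is one-to-one, unequal letters give unequal blocks.

  If \<open>I\<^sup>+\<close> is infinite, every \<open>n \<ge> 0\<close> eventually lies in the block of index \<open>0\<close>.  The right half of
  \<open>x\<close> is then exhausted by the words \<open>\<tau>\<^sup>i(s\<^sub>i)\<close>, so \<open>x\<close> and \<open>y\<close> agree far to the right if and only
  if only finitely many \<open>s\<^sub>i\<close> differ (\<open>eventually_equal_iff\<close>).  A coincidence of \<open>\<tau>(0)\<close> and \<open>\<tau>(1)\<close> makes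
  every block of every level contain a common block of the level below, which gives arbitrarily long
  common stretches (\<open>equal_on_windows_if_coincidence\<close>).  Without coincidences, one difference at a
  coordinate \<open>n \<ge> 0\<close> forces \<open>x\<^sup>(\<^sup>i\<^sup>)\<^sub>0 \<noteq> y\<^sup>(\<^sup>i\<^sup>)\<^sub>0\<close> for all large \<open>i\<close>, hence a difference at every coordinate
  \<open>m \<ge> 0\<close> (\<open>all_neq_if_no_coincidence\<close>).  With a single non-coincidence, a difference of \<open>x\<^sup>(\<^sup>i\<^sup>)\<^sub>0\<close> and
  \<open>y\<^sup>(\<^sup>i\<^sup>)\<^sub>0\<close> pins \<open>\<delta>\<^sub>i\<close> to that coordinate, and then nothing differs in \<open>s\<^sub>i\<close>.
  If \<open>I\<^sup>+\<close> is finite, the \<open>k\<^sup>+\<close>-th translate has all digits \<open>0\<close> and an infinite \<open>I\<^sup>+\<close>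
  (\<open>k_plus_finite\<close>), and translating changes neither asymptoticity nor equality of the digits.

  For the existence statement it must be known that proximal points have the same digits; this holds
  because the phase \<open>\<delta>\<^sub>0\<close> can be read off a bounded window (\<open>phase_locally_constant\<close>).  Conversely, a
  Li-Yorke pair is found among the points with constant digit \<open>c\<close>, the first of the non-coincidences:
  two such points with different letters at \<open>0\<close> differ in every \<open>s\<^sub>i\<close>.

  All of this presupposes that expansions exist and are unique.  Existence follows from minimality of
  \<open>X\<^sub>\<tau>\<close>.  For uniqueness, if two of the \<open>p\<close> sets \<open>T\<^sup>d \<tau>(X\<^sub>\<tau>)\<close> met, minimality would make
  one of them redundant, and \<open>p - 1\<close> of them would cover \<open>X\<^sub>\<tau>\<close>.  The number of words of length
  \<open>p\<^sup>k + 1\<close> would then be \<open>O((p - 1)\<^sup>k)\<close>, whereas an infinite shift-invariant set has at least \<open>n\<close> words of each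
  length \<open>n\<close> (\<open>phase_unique\<close>).
\<close>

section \<open>Windows in the full shift\<close>

definition agree :: "nat \<Rightarrow> 'a biseq \<Rightarrow> 'a biseq \<Rightarrow> bool" where
  "agree m u v \<longleftrightarrow> (\<forall>i. \<bar>i\<bar> \<le> int m \<longrightarrow> u i = v i)"

definition translate :: "int \<Rightarrow> 'a biseq \<Rightarrow> 'a biseq" where
  "translate k x = (\<lambda>i. x (i + k))"

lemma agree_sym: "agree m u v \<Longrightarrow> agree m v u"
  by (simp add: agree_def)

lemma agree_trans: "agree m u v \<Longrightarrow> agree m v w \<Longrightarrow> agree m u w"
  by (simp add: agree_def)

lemma agree_mono: "agree m u v \<Longrightarrow> n \<le> m \<Longrightarrow> agree n u v"
  by (simp add: agree_def)

lemma translate_0 [simp]: "translate 0 x = x"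
  by (simp add: translate_def)

lemma translate_translate [simp]: "translate k (translate l x) = translate (k + l) x"
  by (simp add: translate_def add.assoc)

lemma translate_apply [simp]: "translate k x i = x (i + k)"
  by (simp add: translate_def)

lemma shift_eq_translate: "shift = translate 1"
  by (simp add: shift_def translate_def fun_eq_iff)


lemma funpow_shift: "(shift ^^ n) x = translate (int n) x"
  by (induction n) (simp_all add: shift_eq_translate ac_simps)

lemma subshift_translate:
  assumes "subshift X" "x \<in> X"
  shows "translate k x \<in> X"
proof -
  have S: "shift ` X = X" using assms(1) by (simp add: subshift_def)
  have step: "translate 1 x \<in> X" if "x \<in> X" for x
    using imageI[OF that, of shift] S by (simp add: shift_eq_translate)
  have fwd: "translate (int n) x \<in> X" if "x \<in> X" for x n
    using that by (induction n) (auto dest: step)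
  have bwd: "translate (- int n) x \<in> X" if "x \<in> X" for x n
    using that
  proof (induction n arbitrary: x)
    case (Suc n)
    from \<open>x \<in> X\<close> S have "x \<in> shift ` X" by simp
    then obtain y where y: "y \<in> X" "x = translate 1 y"
      unfolding shift_eq_translate by (rule imageE)
    show ?case using Suc.IH[OF y(1)] y(2) by simp
  qed simp
  show ?thesis using assms(2) fwd[of x "nat k"] bwd[of x "nat (- k)"] by (cases "k \<ge> 0") auto
qed

lemma openin_full_shift_iff:
  "openin full_shift_topology S \<longleftrightarrow> (\<forall>x\<in>S. \<exists>m. \<forall>u. agree m x u \<longrightarrow> u \<in> S)"
proof
  assume op: "openin full_shift_topology S"
  show "\<forall>x\<in>S. \<exists>m. \<forall>u. agree m x u \<longrightarrow> u \<in> S"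
  proof
    fix x assume "x \<in> S"
    then obtain U where fin: "finite {i. U i \<noteq> UNIV}" and xU: "x \<in> Pi\<^sub>E UNIV U"
      and US: "Pi\<^sub>E UNIV U \<subseteq> S"
      using op unfolding full_shift_topology_def openin_product_topology_alt by auto
    have "finite ((\<lambda>i. nat \<bar>i\<bar>) ` {i. U i \<noteq> UNIV})"
      using fin by simp
    then obtain m where m: "\<forall>k \<in> (\<lambda>i. nat \<bar>i\<bar>) ` {i. U i \<noteq> UNIV}. k \<le> m"
      using finite_nat_set_iff_bounded_le by blast
    have "u \<in> S" if u: "agree m x u" for u
    proof -
      have "u i \<in> U i" for i
      proof (cases "U i = UNIV")
        case False
        then have "nat \<bar>i\<bar> \<le> m" using m by blast
        then have "u i = x i" using u by (simp add: agree_def)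
        then show ?thesis using xU by auto
      qed simp
      then show ?thesis using US by auto
    qed
    then show "\<exists>m. \<forall>u. agree m x u \<longrightarrow> u \<in> S" by blast
  qed
next
  assume *: "\<forall>x\<in>S. \<exists>m. \<forall>u. agree m x u \<longrightarrow> u \<in> S"
  show "openin full_shift_topology S"
    unfolding full_shift_topology_def openin_product_topology_alt
  proof (intro ballI)
    fix x assume "x \<in> S"
    then obtain m where m: "\<forall>u. agree m x u \<longrightarrow> u \<in> S" using * by blast
    let ?U = "\<lambda>i. if \<bar>i\<bar> \<le> int m then {x i} else UNIV"
    have "{i. ?U i \<noteq> UNIV} \<subseteq> {- int m..int m}"
      by (auto split: if_splits)
    then have "finite {i. ?U i \<noteq> UNIV}"
      using finite_subset by blast
    moreover have "x \<in> Pi\<^sub>E UNIV ?U" by auto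
    moreover have "Pi\<^sub>E UNIV ?U \<subseteq> S"
    proof
      fix u assume u: "u \<in> Pi\<^sub>E UNIV ?U"
      have "u i = x i" if "\<bar>i\<bar> \<le> int m" for i
        using PiE_mem[OF u, of i] that by simp
      then have "agree m x u" by (simp add: agree_def)
      then show "u \<in> S" using m by blast
    qed
    ultimately show "\<exists>U. finite {i \<in> UNIV. U i \<noteq> topspace (discrete_topology UNIV)} \<and>
        (\<forall>i\<in>UNIV. openin (discrete_topology UNIV) (U i)) \<and> x \<in> Pi\<^sub>E UNIV U \<and> Pi\<^sub>E UNIV U \<subseteq> S"
      by (intro exI[of _ ?U]) simp
  qed
qed

lemma topspace_full_shift [simp]: "topspace full_shift_topology = UNIV"
  by (simp add: full_shift_topology_def)

lemma closedin_full_shift_iff: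
  "closedin full_shift_topology S \<longleftrightarrow> (\<forall>x. (\<forall>m. \<exists>u\<in>S. agree m x u) \<longrightarrow> x \<in> S)"
  unfolding closedin_def openin_full_shift_iff topspace_full_shift
  by (metis DiffD2 DiffI UNIV_I subset_UNIV)

lemma closedin_full_shiftD:
  "closedin full_shift_topology S \<Longrightarrow> (\<And>m. \<exists>u\<in>S. agree m x u) \<Longrightarrow> x \<in> S"
  by (simp add: closedin_full_shift_iff)

text \<open>
  Sequential compactness of the full shift over a finite alphabet, in the form that is used for all
  compactness arguments below.
\<close>

lemma ex_cluster_point:
  fixes u :: "nat \<Rightarrow> 'a::finite biseq"
  obtains x where "\<And>m N. \<exists>n\<ge>N. agree m x (u n)"
proof -
  have "\<exists>x. \<forall>m N. \<exists>n\<ge>N. agree m x (u n)"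
  proof (rule ccontr)
    assume "\<nexists>x. \<forall>m N. \<exists>n\<ge>N. agree m x (u n)"
    then obtain M K where MK: "\<And>x n. n \<ge> K x \<Longrightarrow> \<not> agree (M x) x (u n)"
      by metis
    have "compact_space (full_shift_topology :: 'a biseq topology)"
      unfolding full_shift_topology_def
      by (simp add: compact_space_product_topology compact_space_discrete_topology)
    moreover have "openin full_shift_topology {v. agree (M x) x v}" for x
      unfolding openin_full_shift_iff by (blast intro: agree_trans)
    moreover have "(\<Union>x. {v. agree (M x) x v}) = UNIV"
      by (auto simp: agree_def)
    ultimately obtain \<F> where F: "finite \<F>" "\<F> \<subseteq> range (\<lambda>x. {v. agree (M x) x v})"
      "UNIV \<subseteq> \<Union>\<F>"
      unfolding compact_space_def compactin_def topspace_full_shift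
      by (elim conjE allE[of _ "range (\<lambda>x. {v. agree (M x) x v})"]) auto
    then obtain B where B: "finite B" "\<F> = (\<lambda>x. {v. agree (M x) x v}) ` B"
      using finite_subset_image[OF F(1,2)] by auto
    define n where "n = Max (insert 0 (K ` B))"
    obtain b where "b \<in> B" "agree (M b) b (u n)"
    proof -
      have "u n \<in> \<Union>\<F>" using F(3) by (rule subsetD) simp
      then show ?thesis using that B(2) by auto
    qed
    moreover have "K b \<le> n"
      unfolding n_def using B(1) \<open>b \<in> B\<close> by (intro Max_ge) auto
    ultimately show False using MK by blast
  qed
  then show ?thesis using that by blast
qed

section \<open>Pairs of points\<close>

text \<open>
  The two combinatorial relations below are what asymptotic and proximal pairs amount to for any
  compatible metric: the metric is exchanged for windows once and for all.  Proximality asks for windows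
  of every length arbitrarily far to the right, and distality is its negation.
\<close>

definition eventually_equal :: "'a biseq \<Rightarrow> 'a biseq \<Rightarrow> bool" where
  "eventually_equal x y \<longleftrightarrow> (\<exists>N. \<forall>n\<ge>N. x n = y n)"

definition equal_on_windows :: "'a biseq \<Rightarrow> 'a biseq \<Rightarrow> bool" where
  "equal_on_windows x y \<longleftrightarrow> (\<forall>m N. \<exists>n\<ge>N. agree m (translate n x) (translate n y))"

locale subshift_metric =
  fixes X :: "'a::finite biseq set" and \<rho> :: "'a biseq \<Rightarrow> 'a biseq \<Rightarrow> real"
  assumes compat: "compatible_metric X \<rho>"
    and subshift: "subshift X"
begin

sublocale Metric_space X \<rho>
  using compat by (simp add: compatible_metric_def)

lemma mtop: "mtopology = subtopology full_shift_topology X"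
  using compat by (simp add: compatible_metric_def)

lemma closed: "closedin full_shift_topology X"
  using subshift by (simp add: subshift_def)

lemma agree_imp_close:
  assumes "u \<in> X" "0 < e"
  shows "\<exists>m. \<forall>v\<in>X. agree m u v \<longrightarrow> \<rho> u v < e"
proof -
  have "openin (subtopology full_shift_topology X) (mball u e)"
    using openin_mball mtop by metis
  then obtain V where V: "openin full_shift_topology V" "mball u e = V \<inter> X"
    unfolding openin_subtopology by blast
  have "u \<in> V" using V(2) assms by (metis IntD1 centre_in_mball_iff)
  then obtain m where "\<forall>v. agree m u v \<longrightarrow> v \<in> V"
    using V(1) unfolding openin_full_shift_iff by blast
  then have "\<forall>v\<in>X. agree m u v \<longrightarrow> v \<in> mball u e" using V(2) by blast
  then show ?thesis by (auto simp: in_mball)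
qed

lemma close_imp_agree:
  assumes "u \<in> X"
  shows "\<exists>e>0. \<forall>v\<in>X. \<rho> u v < e \<longrightarrow> agree m u v"
proof -
  have "openin full_shift_topology {v. agree m u v}"
    unfolding openin_full_shift_iff by (blast intro: agree_trans)
  then have "openin mtopology ({v. agree m u v} \<inter> X)"
    unfolding mtop openin_subtopology by blast
  moreover have "u \<in> {v. agree m u v} \<inter> X" using assms by (simp add: agree_def)
  ultimately obtain r where "r > 0" "mball u r \<subseteq> {v. agree m u v} \<inter> X"
    unfolding openin_mtopology by metis
  then show ?thesis using assms by (intro exI[of _ r]) (auto simp: in_mball subset_iff)
qed

text \<open>
  Compactness makes the radius and the window of the two preceding lemmas independent of the point: a
  sequence of counterexamples has a cluster point, at which the pointwise statement fails.
\<close>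

lemma agree_imp_close_uniform:
  assumes "0 < e"
  shows "\<exists>m. \<forall>u\<in>X. \<forall>v\<in>X. agree m u v \<longrightarrow> \<rho> u v < e"
proof (rule ccontr)
  assume "\<not> ?thesis"
  then obtain u v where uv: "\<And>m. u m \<in> X" "\<And>m. v m \<in> X" "\<And>m. agree m (u m) (v m)"
    "\<And>m. \<not> \<rho> (u m) (v m) < e"
    by metis
  obtain x where x: "\<And>m N. \<exists>n\<ge>N. agree m x (u n)"
    using ex_cluster_point[of u] by metis
  have "x \<in> X" using closedin_full_shiftD[OF closed] x uv(1) by metis
  then obtain m where m: "\<And>w. w \<in> X \<Longrightarrow> agree m x w \<Longrightarrow> \<rho> x w < e / 2"
    using agree_imp_close[of x "e / 2"] assms by auto
  obtain n where n: "n \<ge> m" "agree m x (u n)" using x by blast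
  have "agree m x (v n)"
    using agree_trans[OF n(2) agree_mono[OF uv(3) n(1)]] .
  then have *: "\<rho> x (v n) < e / 2"
    by (rule m[OF uv(2)])
  have "\<rho> x (u n) < e / 2"
    by (rule m[OF uv(1) n(2)])
  moreover have "\<rho> (u n) x = \<rho> x (u n)" by (rule commute)
  moreover have "\<rho> (u n) (v n) \<le> \<rho> (u n) x + \<rho> x (v n)"
    by (rule triangle[OF uv(1) \<open>x \<in> X\<close> uv(2)])
  ultimately show False using uv(4)[of n] * by linarith
qed

lemma close_imp_agree_uniform:
  "\<exists>e>0. \<forall>u\<in>X. \<forall>v\<in>X. \<rho> u v < e \<longrightarrow> agree m u v"
proof (rule ccontr)
  assume "\<not> ?thesis"
  then have neg: "\<forall>e>0. \<exists>u\<in>X. \<exists>v\<in>X. \<rho> u v < e \<and> \<not> agree m u v"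
    by simp
  have "\<exists>w. fst w \<in> X \<and> snd w \<in> X \<and> \<rho> (fst w) (snd w) < inverse (real (Suc k)) \<and>
      \<not> agree m (fst w) (snd w)" for k
    using neg[rule_format, of "inverse (real (Suc k))"] by auto
  then obtain w where w: "\<And>k. fst (w k) \<in> X \<and> snd (w k) \<in> X \<and>
      \<rho> (fst (w k)) (snd (w k)) < inverse (real (Suc k)) \<and> \<not> agree m (fst (w k)) (snd (w k))"
    by metis
  define u v where "u k = fst (w k)" and "v k = snd (w k)" for k
  have uv: "u k \<in> X" "v k \<in> X" "\<rho> (u k) (v k) < inverse (real (Suc k))"
    "\<not> agree m (u k) (v k)" for k
    using w[of k] by (simp_all add: u_def v_def)
  obtain x where x: "\<And>m N. \<exists>n\<ge>N. agree m x (u n)"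
    using ex_cluster_point[of u] by metis
  have xX: "x \<in> X" using closedin_full_shiftD[OF closed] x uv(1) by metis
  then obtain e where e: "e > 0" "\<And>w. w \<in> X \<Longrightarrow> \<rho> x w < e \<Longrightarrow> agree m x w"
    using close_imp_agree by blast
  obtain l where l: "\<And>w. w \<in> X \<Longrightarrow> agree l x w \<Longrightarrow> \<rho> x w < e / 2"
    using agree_imp_close[OF xX, of "e / 2"] e(1) by auto
  obtain k where k: "inverse (real (Suc k)) < e / 2"
    using reals_Archimedean[of "e / 2"] e(1) by auto
  obtain n where n: "n \<ge> k" "agree (max l m) x (u n)" using x by blast
  have "\<rho> x (u n) < e / 2"
    using l[OF uv(1) agree_mono[OF n(2)]] by simp
  moreover have "inverse (real (Suc n)) \<le> inverse (real (Suc k))"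
    using n(1) by (simp add: field_simps)
  then have "\<rho> (u n) (v n) < e / 2" using uv(3)[of n] k by linarith
  ultimately have "\<rho> x (v n) < e"
    using triangle[OF xX uv(1)[of n] uv(2)[of n]] by linarith
  then have "agree m x (v n)" using e(2) uv(2) by blast
  moreover have "agree m x (u n)" using agree_mono[OF n(2)] by simp
  ultimately show False
    using uv(4)[of n] agree_trans[OF agree_sym[of m x "u n"], of "v n"] by simp
qed

lemma translate_in: "x \<in> X \<Longrightarrow> translate k x \<in> X"
  by (rule subshift_translate[OF subshift])

lemma asymptotic_pair_iff:
  assumes "x \<in> X" "y \<in> X"
  shows "asymptotic_pair \<rho> x y \<longleftrightarrow> eventually_equal x y"
proof
  assume as: "asymptotic_pair \<rho> x y"
  obtain e where e: "e > 0" "\<And>u v. u \<in> X \<Longrightarrow> v \<in> X \<Longrightarrow> \<rho> u v < e \<Longrightarrow> agree 0 u v"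
    using close_imp_agree_uniform[of 0] by blast
  obtain N where N: "\<And>n. n \<ge> N \<Longrightarrow> \<rho> (translate (int n) x) (translate (int n) y) < e"
    using LIMSEQ_D[OF as[unfolded asymptotic_pair_def] e(1)] by (fastforce simp: funpow_shift)
  have "x n = y n" if "n \<ge> int N" for n
  proof -
    have "agree 0 (translate n x) (translate n y)"
      using e(2) translate_in assms N[of "nat n"] that by simp
    then show ?thesis by (simp add: agree_def)
  qed
  then show "eventually_equal x y" unfolding eventually_equal_def by blast
next
  assume "eventually_equal x y"
  then obtain N where N: "\<And>n. n \<ge> N \<Longrightarrow> x n = y n" unfolding eventually_equal_def by blast
  show "asymptotic_pair \<rho> x y"
    unfolding asymptotic_pair_def
  proof (rule LIMSEQ_I)
    fix e :: real assume "0 < e"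
    then obtain m where m: "\<And>u v. u \<in> X \<Longrightarrow> v \<in> X \<Longrightarrow> agree m u v \<Longrightarrow> \<rho> u v < e"
      using agree_imp_close_uniform by metis
    have "\<rho> (translate (int n) x) (translate (int n) y) < e" if "n \<ge> nat (N + int m)" for n
      by (rule m) (use that N assms translate_in in \<open>auto simp: agree_def\<close>)
    then show "\<exists>no. \<forall>n\<ge>no. norm (\<rho> ((shift ^^ n) x) ((shift ^^ n) y) - 0) < e"
      by (intro exI[of _ "nat (N + int m)"]) (simp add: funpow_shift)
  qed
qed

lemma distal_pair_iff:
  assumes "x \<in> X" "y \<in> X"
  shows "distal_pair \<rho> x y \<longleftrightarrow> \<not> equal_on_windows x y"
proof
  assume "distal_pair \<rho> x y"
  then obtain c where c: "0 < ereal c" "ereal c < dist_liminf \<rho> x y"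
    unfolding distal_pair_def using ereal_dense2 by blast
  have "eventually (\<lambda>n. ereal c < ereal (\<rho> ((shift ^^ n) x) ((shift ^^ n) y))) sequentially"
    using less_LiminfD c(2) unfolding dist_liminf_def by blast
  then obtain N where N: "\<And>n. n \<ge> N \<Longrightarrow> c < \<rho> (translate (int n) x) (translate (int n) y)"
    unfolding eventually_sequentially by (auto simp: funpow_shift)
  obtain m where m: "\<And>u v. u \<in> X \<Longrightarrow> v \<in> X \<Longrightarrow> agree m u v \<Longrightarrow> \<rho> u v < c"
    using agree_imp_close_uniform[of c] c(1) by auto
  have "\<not> agree m (translate n x) (translate n y)" if "n \<ge> int N" for n
  proof
    assume "agree m (translate n x) (translate n y)"
    then have "\<rho> (translate n x) (translate n y) < c" using m translate_in assms by blast
    moreover have "int N \<le> n" "N \<le> nat n" "0 \<le> n" using that by linarith+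
    ultimately show False using N[of "nat n"] by simp
  qed
  then show "\<not> equal_on_windows x y" unfolding equal_on_windows_def by blast
next
  assume "\<not> equal_on_windows x y"
  then obtain m N where mN: "\<And>n. n \<ge> N \<Longrightarrow> \<not> agree m (translate n x) (translate n y)"
    unfolding equal_on_windows_def by blast
  obtain e where e: "e > 0" "\<And>u v. u \<in> X \<Longrightarrow> v \<in> X \<Longrightarrow> \<rho> u v < e \<Longrightarrow> agree m u v"
    using close_imp_agree_uniform[of m] by blast
  have "ereal e \<le> ereal (\<rho> ((shift ^^ n) x) ((shift ^^ n) y))" if "n \<ge> nat N" for n
    using mN[of "int n"] e(2) translate_in assms that unfolding funpow_shift
    by (metis ereal_less_eq(3) nat_le_iff not_le)
  then have "ereal e \<le> dist_liminf \<rho> x y"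
    unfolding dist_liminf_def by (intro Liminf_bounded) (auto simp: eventually_sequentially)
  then show "distal_pair \<rho> x y"
    unfolding distal_pair_def using e(1) by (meson ereal_less(2) less_le_trans)
qed

lemma proximal_pair_iff:
  assumes "x \<in> X" "y \<in> X"
  shows "proximal_pair \<rho> x y \<longleftrightarrow> equal_on_windows x y"
proof -
  have "0 \<le> dist_liminf \<rho> x y"
    unfolding dist_liminf_def by (intro Liminf_bounded) simp
  then show ?thesis
    using distal_pair_iff[OF assms] unfolding distal_pair_def proximal_pair_def by auto
qed

end

section \<open>Substitutions of constant length\<close>

lemma subst_word_append: "subst_word \<tau> (v @ w) = subst_word \<tau> v @ subst_word \<tau> w"
  by (simp add: subst_word_def)

lemma sublist_subst_word: "sublist v w \<Longrightarrow> sublist (subst_word \<tau> v) (subst_word \<tau> w)"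
proof -
  assume "sublist v w"
  then obtain ps ss where "w = ps @ v @ ss" unfolding sublist_def by blast
  then have "subst_word \<tau> w = subst_word \<tau> ps @ subst_word \<tau> v @ subst_word \<tau> ss"
    by (simp add: subst_word_append)
  then show ?thesis unfolding sublist_def by blast
qed

lemma sublist_funpow_subst_word:
  "sublist v w \<Longrightarrow> sublist ((subst_word \<tau> ^^ n) v) ((subst_word \<tau> ^^ n) w)"
  by (induction n) (auto intro: sublist_subst_word)

lemma sublist_singleton: "a \<in> set w \<Longrightarrow> sublist [a] w"
  unfolding sublist_def by (auto dest: split_list)

definition window :: "'a biseq \<Rightarrow> int \<Rightarrow> nat \<Rightarrow> 'a list" where
  "window x k n = map (\<lambda>j. x (k + int j)) [0..<n]"

lemma length_window [simp]: "length (window x k n) = n"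
  by (simp add: window_def)

lemma nth_window [simp]: "j < n \<Longrightarrow> window x k n ! j = x (k + int j)"
  by (simp add: window_def)

lemma window_add: "window x k (m + n) = window x k m @ window x (k + int m) n"
  by (rule nth_equalityI) (auto simp: nth_append)

lemma window_translate: "window (translate l x) k n = window x (k + l) n"
  by (simp add: window_def algebra_simps)

lemma sublist_window:
  assumes "l \<le> k" "k + int n \<le> l + int m"
  shows "sublist (window x k n) (window x l m)"
proof -
  define a where "a = nat (k - l)"
  define b where "b = nat (l + int m - (k + int n))"
  have k: "k = l + int a" and m: "m = a + (n + b)" using assms unfolding a_def b_def by linarith+
  have "window x l m = window x l a @ window x k n @ window x (k + int n) b"
    unfolding m window_add k by simp
  then show ?thesis unfolding sublist_def by blast
qed

lemma window_eq_sublist: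
  assumes "sublist v (window x k n)"
  obtains l where "k \<le> l" "l + int (length v) \<le> k + int n" "window x l (length v) = v"
proof -
  obtain ps ss where e: "window x k n = ps @ v @ ss" using assms unfolding sublist_def by blast
  have len: "n = length ps + (length v + length ss)" using arg_cong[OF e, of length] by simp
  have "window x (k + int (length ps)) (length v) = v"
    using e unfolding len window_add by (simp add: append_eq_append_conv)
  then show ?thesis using that[of "k + int (length ps)"] len by simp
qed

lemma agree_iff_window:
  "agree m (translate k x) (translate l y) \<longleftrightarrow>
     window x (k - int m) (2 * m + 1) = window y (l - int m) (2 * m + 1)" (is "?A \<longleftrightarrow> ?W")
proof
  assume A: ?A
  show ?W
  proof (rule nth_equalityI)
    fix j assume "j < length (window x (k - int m) (2 * m + 1))"
    then show "window x (k - int m) (2 * m + 1) ! j = window y (l - int m) (2 * m + 1) ! j"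
      using A[unfolded agree_def, rule_format, of "int j - int m"] by (simp add: algebra_simps)
  qed simp
next
  assume W: ?W
  show ?A
    unfolding agree_def
  proof (intro allI impI)
    fix i assume "\<bar>i\<bar> \<le> int m"
    then have j: "nat (i + int m) < 2 * m + 1" "int (nat (i + int m)) = i + int m" by linarith+
    then show "translate k x i = translate l y i"
      using arg_cong[OF W, of "\<lambda>w. w ! nat (i + int m)"] by (simp add: algebra_simps)
  qed
qed

locale constant_length_substitution =
  fixes \<tau> :: "'a::finite \<Rightarrow> 'a list" and p :: nat
  assumes const_len: "constant_length \<tau> p" and p_ge_2: "p \<ge> 2"
begin

lemma length_subst [simp]: "length (\<tau> a) = p"
  using const_len by (simp add: constant_length_def)

lemma p_pos: "0 < p" "0 < int p"
  using p_ge_2 by simp_all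

lemma length_subst_word: "length (subst_word \<tau> w) = p * length w"
  by (induction w) (simp_all add: subst_word_def)

lemma nth_subst_word:
  "j < p * length w \<Longrightarrow> subst_word \<tau> w ! j = \<tau> (w ! (j div p)) ! (j mod p)"
proof (induction w arbitrary: j)
  case (Cons a w)
  show ?case
  proof (cases "j < p")
    case True
    then show ?thesis by (simp add: subst_word_def nth_append)
  next
    case False
    then have "j div p = Suc ((j - p) div p)" "(j - p) mod p = j mod p"
      using p_pos by (simp_all add: le_div_geq le_mod_geq)
    moreover have "subst_word \<tau> (a # w) ! j = subst_word \<tau> w ! (j - p)"
      using False by (simp add: subst_word_def nth_append)
    ultimately show ?thesis using Cons.IH[of "j - p"] Cons.prems False by simp
  qed
qed simp

lemma length_funpow_subst_word: "length ((subst_word \<tau> ^^ n) w) = p ^ n * length w"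
  by (induction n) (simp_all add: length_subst_word)

text \<open>
  For constant length the two clauses of \<^const>\<open>subst_seq\<close> merge into one formula, since division and
  remainder on the integers round downwards on both sides of \<open>0\<close>.
\<close>

lemma subst_seq_apply:
  "subst_seq \<tau> x i = \<tau> (x (i div int p)) ! nat (i mod int p)"
proof (cases "0 \<le> i")
  case True
  define n where "n = nat i"
  have i: "i = int n" using True by (simp add: n_def)
  have dm: "nat (i mod int p) = n mod p" "i div int p = int (n div p)" "n div p \<le> n"
    by (simp_all add: i zdiv_int flip: zmod_int)
  have "n < p * Suc n" using p_pos by (cases p) auto
  then have "subst_word \<tau> (map x [0..i]) ! n = \<tau> (map x [0..i] ! (n div p)) ! (n mod p)"
    by (intro nth_subst_word) (simp add: i nat_add_distrib)
  moreover have "map x [0..i] ! (n div p) = x (int (n div p))"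
  proof -
    have "int (n div p) \<le> int n" "n div p < length [0..int n]" using dm(3) by (simp_all add: nat_add_distrib less_Suc_eq_le flip: of_nat_div)
    then show ?thesis unfolding i by (simp only: nth_map nth_upto add_0)
  qed
  ultimately show ?thesis using True dm unfolding subst_seq_def by (simp add: n_def)
next
  case False
  define n where "n = nat (- i)"
  have i: "i = - int n" "n > 0" using False by (simp_all add: n_def)
  define j where "j = p * n - n"
  have nle: "n \<le> p * n" using p_pos by simp
  have j: "int j = i + int p * int n" unfolding j_def i using nle by (simp add: of_nat_diff)
  have dm: "int (j mod p) = i mod int p" "int (j div p) = i div int p + int n"
    using p_pos by (simp_all add: zmod_int zdiv_int j)
  have lt: "j < p * n" using i(2) p_pos by (simp add: j_def)
  have lt': "j div p < n" using lt by (simp add: less_mult_imp_div_less mult.commute)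
  let ?w = "map x [i..-1]"
  have len: "length ?w = n" by (simp add: i)
  have "subst_word \<tau> ?w ! j = \<tau> (?w ! (j div p)) ! (j mod p)"
    by (rule nth_subst_word) (use lt len in simp)
  moreover have "?w ! (j div p) = x (i div int p)"
    using lt' dm(2) by (simp add: i)
  moreover have "nat (i mod int p) = j mod p" using dm(1) by simp
  ultimately show ?thesis
    using False unfolding subst_seq_def Let_def length_subst_word len
    by (simp add: j_def n_def)
qed

text \<open>
  The map \<open>T\<^sup>d \<circ> \<tau>\<close>, whose inverse branches are the steps of an expansion.
\<close>

definition prolong :: "nat \<Rightarrow> 'a biseq \<Rightarrow> 'a biseq" where
  "prolong d z = translate (int d) (subst_seq \<tau> z)"

lemma prolong_apply:
  "prolong d z i = \<tau> (z ((i + int d) div int p)) ! nat ((i + int d) mod int p)"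
  by (simp add: prolong_def subst_seq_apply)

lemma prolong_eq_shift: "prolong d z = (shift ^^ d) (subst_seq \<tau> z)"
  by (simp add: prolong_def funpow_shift)

text \<open>
  This identity expresses \<open>T\<^sup>p \<circ> \<tau> = \<tau> \<circ> T\<close> with a carry: it is the rule by which translating a point
  changes its first digit and its desubstitution.
\<close>

lemma translate_prolong:
  assumes "k + int d = l * int p + int e"
  shows "translate k (prolong d z) = prolong e (translate l z)"
proof
  fix i
  have *: "i + k + int d = (i + int e) + l * int p" using assms by simp
  show "translate k (prolong d z) i = prolong e (translate l z) i"
    unfolding prolong_apply translate_apply * using p_pos by (simp add: add.commute)
qed

lemma agree_prolong:
  assumes "agree (Suc m) z w" "d < p"
  shows "agree m (prolong d z) (prolong d w)"
  unfolding agree_def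
proof (intro allI impI)
  fix i assume i: "\<bar>i\<bar> \<le> int m"
  have "int m + int d \<le> int m * int p + int p"
    using mult_left_mono[of 1 "int p" "int m"] assms(2) p_pos by simp
  then have "(i + int d) div int p \<le> int (Suc m)"
    using zdiv_mono1[of "i + int d" "int (Suc m) * int p" "int p"] p_pos i
    by (simp add: algebra_simps)
  moreover have "- int m * int p \<le> i + int d"
    using mult_left_mono[of 1 "int p" "int m"] p_pos i by simp
  then have "- int m \<le> (i + int d) div int p"
    using zdiv_mono1[of "- int m * int p" "i + int d" "int p"] p_pos
    unfolding nonzero_mult_div_cancel_right[OF p_pos(2)[THEN less_imp_neq, symmetric]] by blast
  ultimately have "z ((i + int d) div int p) = w ((i + int d) div int p)"
    using assms(1) by (simp add: agree_def)
  then show "prolong d z i = prolong d w i" by (simp add: prolong_apply)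
qed

lemma closedin_prolong_image:
  assumes "closedin full_shift_topology Z" "d < p"
  shows "closedin full_shift_topology (prolong d ` Z)"
  unfolding closedin_full_shift_iff
proof (intro allI impI)
  fix x assume "\<forall>m. \<exists>u\<in>prolong d ` Z. agree m x u"
  then have "\<forall>m. \<exists>z\<in>Z. agree m x (prolong d z)" by simp
  then obtain z where z: "\<And>m. z m \<in> Z" "\<And>m. agree m x (prolong d (z m))"
    by metis
  obtain w where w: "\<And>m N. \<exists>n\<ge>N. agree m w (z n)"
    using ex_cluster_point[of z] by metis
  have "w \<in> Z" by (rule closedin_full_shiftD[OF assms(1)]) (use w z(1) in blast)
  moreover have "x i = prolong d w i" for i
  proof -
    obtain n where n: "n \<ge> nat \<bar>i\<bar>" "agree (Suc (nat \<bar>i\<bar>)) w (z n)" using w by blast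
    have "prolong d w i = prolong d (z n) i"
      using agree_prolong[OF n(2) assms(2)] by (simp add: agree_def)
    moreover have "x i = prolong d (z n) i"
      using z(2)[of n] n(1) by (simp add: agree_def)
    ultimately show ?thesis by simp
  qed
  then have "x = prolong d w" by blast
  ultimately show "x \<in> prolong d ` Z" by blast
qed

lemma prolong_inj:
  assumes "inj \<tau>" "prolong d z = prolong d w"
  shows "z = w"
proof
  fix i
  have "\<tau> (z i) = \<tau> (w i)"
  proof (rule nth_equalityI)
    fix r assume "r < length (\<tau> (z i))"
    then have r: "r < p" by simp
    show "\<tau> (z i) ! r = \<tau> (w i) ! r"
      using fun_cong[OF assms(2), of "i * int p + int r - int d"] r p_pos
      by (simp add: prolong_apply)
  qed simp
  then show "z i = w i" using assms(1) by (simp add: inj_def)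
qed

end

section \<open>The minimal subshift of a primitive substitution\<close>

locale primitive_substitution = constant_length_substitution +
  assumes prim: "primitive_subst \<tau>"
begin

abbreviation iter :: "nat \<Rightarrow> 'a \<Rightarrow> 'a list" where
  "iter n a \<equiv> (subst_word \<tau> ^^ n) [a]"

lemma length_iter: "length (iter n a) = p ^ n"
  by (simp add: length_funpow_subst_word)

lemma iter_add: "iter (m + n) a = (subst_word \<tau> ^^ m) (iter n a)"
  by (simp add: funpow_add)

lemma iter_nonempty: "iter n a \<noteq> []"
  using length_iter[of n a] p_pos by auto

text \<open>
  By primitivity every \<open>\<tau>\<^sup>n(b)\<close> with \<open>n\<close> large contains all letters, and \<open>\<tau>\<^sup>N\<close> is applied to both sides.
\<close>

lemma ex_sublist_iter: "\<exists>K. \<forall>n\<ge>K. \<forall>N a b. sublist (iter N a) (iter (N + n) b)"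
proof -
  obtain K where K: "\<And>a b. a \<in> set (iter K b)"
    using prim unfolding primitive_subst_def by blast
  have "sublist (iter N a) (iter (N + n) b)" if "n \<ge> K" for n N a b
  proof -
    define w where "w = iter (n - K) b"
    have "w \<noteq> []" unfolding w_def by (rule iter_nonempty)
    then obtain c where "c \<in> set w" by (cases w) auto
    then have "sublist (iter K c) ((subst_word \<tau> ^^ K) w)"
      by (intro sublist_funpow_subst_word sublist_singleton)
    then have "set (iter K c) \<subseteq> set (iter n b)"
      using iter_add[of K "n - K" b] that by (simp add: w_def set_mono_sublist)
    then have "sublist [a] (iter n b)"
      by (intro sublist_singleton) (use K in blast)
    then show ?thesis
      unfolding iter_add by (rule sublist_funpow_subst_word)
  qed
  then show ?thesis by blast
qed

text \<open>
  The word \<open>\<tau>\<^sup>K(w)\<close> is a concatenation of blocks of length \<open>p\<^sup>K\<close>, and a stretch of twice that length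
  cannot avoid containing a whole block.
\<close>

lemma iter_sublist_of_long_sublist:
  assumes "sublist v ((subst_word \<tau> ^^ K) w)" "2 * p ^ K \<le> length v"
  shows "\<exists>b. sublist (iter K b) v"
  using assms
proof (induction w)
  case Nil
  then have "length v \<le> 0"
    using sublist_length_le[OF Nil.prems(1)] by (simp add: length_funpow_subst_word)
  then show ?case using Nil.prems(2) p_pos by simp
next
  case (Cons b w)
  have split: "(subst_word \<tau> ^^ K) (c # u) = iter K c @ (subst_word \<tau> ^^ K) u" for c u
    by (induction K) (simp_all add: subst_word_append)
  have pK: "p ^ K > 0" using p_pos by simp
  consider "sublist v (iter K b)" | "sublist v ((subst_word \<tau> ^^ K) w)"
    | v1 v2 where "v = v1 @ v2" "suffix v1 (iter K b)" "prefix v2 ((subst_word \<tau> ^^ K) w)"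
    using Cons.prems(1) unfolding split[of b w] sublist_append by blast
  then show ?case
  proof cases
    case 1
    then show ?thesis
      using sublist_length_le[OF 1] Cons.prems(2) pK by (simp add: length_funpow_subst_word)
  next
    case 2
    then show ?thesis using Cons.IH Cons.prems(2) by blast
  next
    case 3
    have "length v1 \<le> p ^ K"
      using suffix_length_le[OF 3(2)] by (simp add: length_funpow_subst_word)
    then have len: "p ^ K \<le> length v2" using Cons.prems(2) 3(1) by simp
    then have "(subst_word \<tau> ^^ K) w \<noteq> []" using prefix_length_le[OF 3(3)] pK by auto
    then obtain c u where w: "w = c # u"
      using length_funpow_subst_word[of K w] by (cases w) auto
    have "prefix (iter K c) v2"
    proof (rule prefix_length_prefix)
      show "prefix (iter K c) ((subst_word \<tau> ^^ K) w)" unfolding w split[of c u] by simp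
      show "length (iter K c) \<le> length v2" unfolding length_iter by (rule len)
    qed (rule 3(3))
    then have "sublist (iter K c) v2" by (rule prefix_imp_sublist)
    then have "sublist (iter K c) v"
      unfolding 3(1) by (rule sublist_order.order.trans) (rule sublist_append_leftI)
    then show ?thesis by blast
  qed
qed

definition lang :: "'a list set" where
  "lang = {v. \<exists>n a. sublist v (iter n a)}"

lemma lang_sublist: "v \<in> lang \<Longrightarrow> sublist u v \<Longrightarrow> u \<in> lang"
  unfolding lang_def by (blast intro: sublist_order.order.trans)

lemma iter_in_lang: "iter n a \<in> lang"
  unfolding lang_def by blast

lemma subst_word_in_lang: "v \<in> lang \<Longrightarrow> subst_word \<tau> v \<in> lang"
proof -
  assume "v \<in> lang"
  then obtain n a where "sublist v (iter n a)" unfolding lang_def by blast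
  then have "sublist (subst_word \<tau> v) (iter (Suc n) a)" by (simp add: sublist_subst_word)
  then show ?thesis unfolding lang_def by blast
qed

text \<open>
  The source of minimality: a word of \<open>\<tau>\<^sup>n(a)\<close> lies in every \<open>\<tau>\<^bsup>n+K\<^esup>(b)\<close>, and a long word of the language
  contains one of these blocks.
\<close>

lemma lang_uniformly_recurrent:
  assumes "v \<in> lang"
  shows "\<exists>L. \<forall>u\<in>lang. length u \<ge> L \<longrightarrow> sublist v u"
proof -
  obtain n a where v: "sublist v (iter n a)" using assms unfolding lang_def by blast
  obtain K where K: "\<And>n N a b. n \<ge> K \<Longrightarrow> sublist (iter N a) (iter (N + n) b)"
    using ex_sublist_iter by blast
  have "sublist v u" if u: "u \<in> lang" "length u \<ge> 2 * p ^ (n + K)" for u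
  proof -
    obtain N c where "sublist u (iter N c)" using u(1) unfolding lang_def by blast
    then have "sublist u (iter (N + (n + K)) c)"
      by (rule sublist_order.order.trans) (rule K, simp)
    then have "sublist u ((subst_word \<tau> ^^ (n + K)) (iter N c))"
      by (simp only: add.commute[of N] iter_add)
    then obtain b where "sublist (iter (n + K) b) u"
      using iter_sublist_of_long_sublist u(2) by blast
    moreover have "sublist v (iter (n + K) b)"
      by (rule sublist_order.order.trans[OF v K]) simp
    ultimately show ?thesis by (rule sublist_order.order.trans[rotated])
  qed
  then show ?thesis by blast
qed

text \<open>
  An explicit description of \<^term>\<open>subst_shift \<tau>\<close> by its language; see \<open>subst_shift_eq\<close>.
\<close>

definition lang_shift :: "'a biseq set" where
  "lang_shift = {x. \<forall>k n. window x k n \<in> lang}"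

lemma translate_in_lang_shift: "x \<in> lang_shift \<Longrightarrow> translate k x \<in> lang_shift"
  by (simp add: lang_shift_def window_translate)

lemma lang_shiftI:
  assumes "\<And>m. \<exists>w\<in>lang. sublist (window x (- int m) (2 * m + 1)) w"
  shows "x \<in> lang_shift"
  unfolding lang_shift_def
proof (intro CollectI allI)
  fix k n
  define m where "m = nat \<bar>k\<bar> + n"
  have "sublist (window x k n) (window x (- int m) (2 * m + 1))"
    by (rule sublist_window) (simp_all add: m_def)
  moreover obtain w where w: "w \<in> lang" "sublist (window x (- int m) (2 * m + 1)) w"
    using assms[of m] by blast
  ultimately show "window x k n \<in> lang"
    by (intro lang_sublist[OF w(1)] sublist_order.order.trans[OF _ w(2)])
qed

lemma closedin_lang_shift: "closedin full_shift_topology lang_shift"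
  unfolding closedin_full_shift_iff
proof (intro allI impI)
  fix x assume x: "\<forall>m. \<exists>u\<in>lang_shift. agree m x u"
  show "x \<in> lang_shift"
  proof (rule lang_shiftI)
    fix m
    obtain u where u: "u \<in> lang_shift" "agree m x u" using x by blast
    have "window x (- int m) (2 * m + 1) = window u (- int m) (2 * m + 1)"
      using agree_iff_window[of m 0 x 0 u] u(2) by simp
    then show "\<exists>w\<in>lang. sublist (window x (- int m) (2 * m + 1)) w"
      using u(1) unfolding lang_shift_def by (auto intro!: bexI)
  qed
qed

lemma subshift_lang_shift: "subshift lang_shift"
proof -
  have "x \<in> shift ` lang_shift" if "x \<in> lang_shift" for x
    using translate_in_lang_shift[OF that, of "- 1"]
    by (intro image_eqI[of _ _ "translate (- 1) x"]) (simp_all add: shift_eq_translate)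
  then show ?thesis
    using closedin_lang_shift translate_in_lang_shift
    unfolding subshift_def shift_eq_translate by blast
qed

lemma lang_window_occurs:
  assumes "v \<in> lang" "y \<in> lang_shift"
  shows "\<exists>k. window y k (length v) = v"
proof -
  obtain L where L: "\<And>u. u \<in> lang \<Longrightarrow> length u \<ge> L \<Longrightarrow> sublist v u"
    using lang_uniformly_recurrent[OF assms(1)] by blast
  have "sublist v (window y 0 L)"
    using assms(2) by (intro L) (simp_all add: lang_shift_def)
  then show ?thesis using window_eq_sublist by metis
qed

lemma dense_orbit:
  assumes "x \<in> lang_shift" "y \<in> lang_shift"
  shows "\<exists>k. agree m x (translate k y)"
proof -
  have "window x (- int m) (2 * m + 1) \<in> lang"
    using assms(1) by (simp add: lang_shift_def)
  then obtain k where "window y k (2 * m + 1) = window x (- int m) (2 * m + 1)"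
    using lang_window_occurs[OF _ assms(2)] by fastforce
  then show ?thesis
    using agree_iff_window[of m 0 x "k + int m" y] by auto
qed

text \<open>
  Centre longer and longer words \<open>\<tau>\<^sup>n(a)\<close> found in \<open>Y\<close> at the origin and take a cluster point.
  Together with density of orbits this puts all of \<^const>\<open>lang_shift\<close> inside \<open>Y\<close>.
\<close>

lemma subshift_meets_lang_shift:
  assumes "subshift Y" "\<And>n a. appears_in (iter n a) Y"
  shows "\<exists>y\<in>Y. y \<in> lang_shift"
proof -
  fix a :: 'a
  have "\<exists>y\<in>Y. sublist (window y (- int n) (2 * n + 1)) (iter (2 * n + 1) a)" for n
  proof -
    define w where "w = iter (2 * n + 1) a"
    obtain x k where x: "x \<in> Y" "\<forall>j<length w. x (k + int j) = w ! j"
      using assms(2)[of "2 * n + 1" a] unfolding appears_in_def w_def by blast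
    have ww: "window x k (length w) = w"
      by (rule nth_equalityI) (use x(2) in simp_all)
    \<comment> \<open>the exponent \<open>2n + 1\<close> makes the word longer than the window \<open>[-n, n]\<close> that it has to fill\<close>
    have "(2 * n + 1) < (2::nat) ^ (2 * n + 1)" by (rule less_exp)
    also have "\<dots> \<le> length w"
      unfolding w_def length_iter using p_ge_2 by (rule power_mono) simp
    finally have "sublist (window x k (2 * n + 1)) w"
      using sublist_window[of k k "2 * n + 1" "length w" x] unfolding ww by simp
    then have "sublist (window (translate (k + int n) x) (- int n) (2 * n + 1)) w"
      unfolding window_translate by simp
    then show ?thesis unfolding w_def using subshift_translate[OF assms(1) x(1)] by blast
  qed
  then obtain u where u: "\<And>n. u n \<in> Y"
    "\<And>n. sublist (window (u n) (- int n) (2 * n + 1)) (iter (2 * n + 1) a)"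
    by metis
  obtain y where y: "\<And>m N. \<exists>n\<ge>N. agree m y (u n)"
    using ex_cluster_point[of u] by metis
  have "y \<in> Y"
  proof (rule closedin_full_shiftD)
    show "closedin full_shift_topology Y" using assms(1) by (simp add: subshift_def)
    show "\<exists>v\<in>Y. agree m y v" for m using y[where m = m] u(1) by blast
  qed
  moreover have "y \<in> lang_shift"
  proof (rule lang_shiftI)
    fix m
    obtain n where n: "n \<ge> m" "agree m y (u n)" using y by blast
    have "window y (- int m) (2 * m + 1) = window (u n) (- int m) (2 * m + 1)"
      using agree_iff_window[of m 0 y 0 "u n"] n(2) by simp
    moreover have "sublist \<dots> (window (u n) (- int n) (2 * n + 1))"
      by (rule sublist_window) (use n(1) in simp_all)
    ultimately have "sublist (window y (- int m) (2 * m + 1)) (iter (2 * n + 1) a)"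
      using sublist_order.order.trans[OF _ u(2)[of n]] by simp
    then show "\<exists>w\<in>lang. sublist (window y (- int m) (2 * m + 1)) w"
      using iter_in_lang by blast
  qed
  ultimately show ?thesis by blast
qed

lemma subst_shift_eq: "subst_shift \<tau> = lang_shift"
  unfolding subst_shift_def
proof (rule Least_equality)
  have full: "\<exists>y\<in>UNIV. y \<in> lang_shift"
  proof (rule subshift_meets_lang_shift)
    have "x \<in> range shift" for x :: "'a biseq"
      by (rule image_eqI[of _ _ "translate (- 1) x"]) (simp_all add: shift_eq_translate)
    then show "subshift (UNIV :: 'a biseq set)"
      unfolding subshift_def closedin_full_shift_iff by auto
    show "appears_in (iter n a) UNIV" for n a
      unfolding appears_in_def by (intro bexI[of _ "\<lambda>i. iter n a ! nat i"] exI[of _ 0]) simp_all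
  qed
  have "appears_in (iter n a) lang_shift" for n a
  proof -
    obtain y where y: "y \<in> lang_shift" using full by blast
    obtain k where k: "window y k (length (iter n a)) = iter n a"
      using lang_window_occurs[OF iter_in_lang y] by blast
    have "y (k + int j) = iter n a ! j" if "j < length (iter n a)" for j
      using nth_window[OF that, of y k] unfolding k by simp
    then show ?thesis unfolding appears_in_def using y by blast
  qed
  then show "subshift lang_shift \<and> (\<forall>n a. appears_in (iter n a) lang_shift)"
    using subshift_lang_shift by blast
next
  fix Y :: "'a biseq set"
  assume Y: "subshift Y \<and> (\<forall>n a. appears_in (iter n a) Y)"
  then obtain y where y: "y \<in> Y" "y \<in> lang_shift"
    using subshift_meets_lang_shift by blast
  show "lang_shift \<subseteq> Y"
  proof
    fix x assume x: "x \<in> lang_shift"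
    show "x \<in> Y"
    proof (rule closedin_full_shiftD)
      show "closedin full_shift_topology Y" using Y by (simp add: subshift_def)
      show "\<exists>u\<in>Y. agree m x u" for m
        using dense_orbit[OF x y(2), of m] subshift_translate y(1) Y by blast
    qed
  qed
qed

lemma prolong_in_lang_shift:
  assumes "z \<in> lang_shift"
  shows "prolong d z \<in> lang_shift"
proof -
  have 0: "window (prolong 0 z) (l * int p) (p * m) = subst_word \<tau> (window z l m)" for l m
  proof (rule nth_equalityI)
    fix j assume "j < length (window (prolong 0 z) (l * int p) (p * m))"
    then have j: "j < p * m" by simp
    then have "j div p < m" by (simp add: less_mult_imp_div_less mult.commute)
    moreover have "(l * int p + int j) div int p = l + int (j div p)"
      "nat ((l * int p + int j) mod int p) = j mod p"
      using p_pos by (simp_all add: zdiv_int nat_mod_as_int)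
    ultimately show "window (prolong 0 z) (l * int p) (p * m) ! j = subst_word \<tau> (window z l m) ! j"
      using j by (simp add: nth_subst_word prolong_apply)
  qed (simp add: length_subst_word)
  have "window (prolong 0 z) k n \<in> lang" for k n
  proof -
    have "sublist (window (prolong 0 z) k n)
        (window (prolong 0 z) (k div int p * int p) (p * (n + 1)))"
    proof (rule sublist_window)
      show "k div int p * int p \<le> k"
        using div_mult_mod_eq[of k "int p"] pos_mod_sign[OF p_pos(2), of k] by linarith
      have "k < k div int p * int p + int p"
        using div_mult_mod_eq[of k "int p"] pos_mod_bound[OF p_pos(2), of k] by linarith
      moreover have "int n \<le> int p * int n"
        using mult_right_mono[of 1 "int p" "int n"] p_pos by simp
      ultimately show "k + int n \<le> k div int p * int p + int (p * (n + 1))"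
        by (simp add: algebra_simps)
    qed
    moreover have "window z (k div int p) (n + 1) \<in> lang"
      using assms unfolding lang_shift_def by blast
    ultimately show ?thesis
      unfolding 0 using lang_sublist subst_word_in_lang by blast
  qed
  then have "prolong 0 z \<in> lang_shift" by (simp add: lang_shift_def)
  moreover have "prolong d z = translate (int d) (prolong 0 z)"
    by (simp add: prolong_def)
  ultimately show ?thesis using translate_in_lang_shift by simp
qed

text \<open>
  The union of the closed sets \<open>T\<^sup>d \<tau>(X)\<close>, \<open>d < p\<close>, contains the orbit of any \<open>\<tau>(z)\<close>, and that orbit is
  dense.
\<close>

lemma lang_shift_cover:
  assumes "x \<in> lang_shift"
  shows "\<exists>d<p. \<exists>z\<in>lang_shift. x = prolong d z"
proof -
  have "closedin full_shift_topology (\<Union>d<p. prolong d ` lang_shift)"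
    by (intro closedin_Union) (auto intro: closedin_prolong_image[OF closedin_lang_shift])
  then have "x \<in> (\<Union>d<p. prolong d ` lang_shift)"
  proof (rule closedin_full_shiftD)
    fix m
    obtain k where k: "agree m x (translate k (prolong 0 x))"
      using dense_orbit[OF assms prolong_in_lang_shift[OF assms]] by blast
    define d where "d = nat (k mod int p)"
    have d: "int d = k mod int p" "d < p" using p_pos by (simp_all add: d_def nat_less_iff)
    have "translate k (prolong 0 x) = prolong d (translate (k div int p) x)"
      by (rule translate_prolong) (simp add: d)
    then show "\<exists>u\<in>(\<Union>d<p. prolong d ` lang_shift). agree m x u"
      using k d(2) translate_in_lang_shift[OF assms] by (intro bexI[of _ "translate k (prolong 0 x)"]) auto
  qed
  then show ?thesis by blast
qed

text \<open>
  If \<open>T\<^sup>d \<tau>(z) = T\<^sup>e \<tau>(w)\<close>, the same equation relates all common translates of \<open>z\<close> and \<open>w\<close>; the orbit of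
  \<open>z\<close> is dense and \<open>T\<^sup>e \<tau>(X)\<close> is closed.
\<close>

lemma prolong_images_eq_or_disjoint:
  assumes "prolong d z = prolong e w" "z \<in> lang_shift" "w \<in> lang_shift" "d < p" "e < p"
  shows "prolong d ` lang_shift \<subseteq> prolong e ` lang_shift"
proof
  fix x assume "x \<in> prolong d ` lang_shift"
  then obtain v where v: "v \<in> lang_shift" "x = prolong d v" by blast
  show "x \<in> prolong e ` lang_shift"
  proof (rule closedin_full_shiftD[OF closedin_prolong_image[OF closedin_lang_shift assms(5)]])
    fix m
    obtain k where k: "agree (Suc m) v (translate k z)"
      using dense_orbit[OF v(1) assms(2)] by blast
    have "prolong d (translate k z) = translate (k * int p) (prolong d z)"
      by (rule translate_prolong[symmetric]) simp
    also have "\<dots> = prolong e (translate k w)"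
      unfolding assms(1) by (rule translate_prolong) simp
    finally have "agree m x (prolong e (translate k w))"
      using agree_prolong[OF k assms(4)] v(2) by simp
    then show "\<exists>u\<in>prolong e ` lang_shift. agree m x u"
      using translate_in_lang_shift[OF assms(3)] by blast
  qed
qed

end

section \<open>Factor complexity and recognizability\<close>

definition complexity :: "'a biseq set \<Rightarrow> nat \<Rightarrow> nat" where
  "complexity X n = card ((\<lambda>x. window x 0 n) ` X)"

lemma finite_windows: "finite ((\<lambda>x :: 'a::finite biseq. window x k n) ` X)"
proof (rule finite_subset)
  show "(\<lambda>x. window x k n) ` X \<subseteq> {w. set w \<subseteq> UNIV \<and> length w = n}" by auto
qed (rule finite_lists_length_eq, simp)

text \<open>
  The argument of Morse and Hedlund.  If there were no more words of length \<open>n + 1\<close> than of length \<open>n\<close>, each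
  word of length \<open>n\<close> would have a single extension to the right, so a window of length \<open>n\<close> would
  determine everything to its right.  Finitely many distinct points can be told apart to the right
  of a suitable position \<open>k\<close>, so there would be no more points than words of length \<open>n\<close>.
\<close>

lemma complexity_strict_mono:
  fixes X :: "'a::finite biseq set"
  assumes inv: "\<And>x k. x \<in> X \<Longrightarrow> translate k x \<in> X" and inf: "infinite X"
  shows "complexity X n < complexity X (Suc n)"
proof (rule ccontr)
  assume le: "\<not> ?thesis"
  let ?W = "\<lambda>n. (\<lambda>x. window x 0 n) ` X"
  have take: "take n (window x k (Suc n)) = window x k n" for x :: "'a biseq" and k
    by (simp add: window_def take_map)
  have img: "take n ` ?W (Suc n) = ?W n"
    by (simp add: image_image take)
  have "card (?W n) \<le> card (?W (Suc n))"
    unfolding img[symmetric] by (intro card_image_le finite_windows)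
  then have inj: "inj_on (take n) (?W (Suc n))"
    using le unfolding complexity_def
    by (intro eq_card_imp_inj_on finite_windows) (simp add: img)
  have ext: "window x 0 (Suc n) = window y 0 (Suc n)"
    if "x \<in> X" "y \<in> X" "window x 0 n = window y 0 n" for x y
    by (rule inj_onD[OF inj]) (use that in \<open>simp_all add: take\<close>)
  have ext: "window x k (Suc n) = window y k (Suc n)"
    if "x \<in> X" "y \<in> X" "window x k n = window y k n" for x y k
    using ext[OF inv[OF that(1), of k] inv[OF that(2), of k]] that(3)
    by (simp add: window_translate)
  have det: "x (k + int j) = y (k + int j)"
    if xy: "x \<in> X" "y \<in> X" "window x k n = window y k n" for x y k j
  proof -
    have w: "window x (k + int i) (Suc n) = window y (k + int i) (Suc n)" for i
    proof (induction i)
      case 0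
      then show ?case using ext[OF xy] by simp
    next
      case (Suc i)
      have *: "window u (k + int i) (Suc n) = window u (k + int i) 1 @ window u (k + int (Suc i)) n"
        for u :: "'a biseq"
        using window_add[of u "k + int i" 1 n] by (simp add: algebra_simps)
      have "window x (k + int (Suc i)) n = window y (k + int (Suc i)) n"
        using Suc.IH unfolding * by simp
      then show ?case by (rule ext[OF xy(1,2)])
    qed
    show ?thesis using arg_cong[OF w[of j], of "\<lambda>w. w ! 0"] by simp
  qed
  obtain F where F: "finite F" "F \<subseteq> X" "card F = Suc (complexity X n)"
    using infinite_arbitrarily_large[OF inf] by metis
  define D where "D x y = (SOME i. x i \<noteq> y i)" for x y :: "'a biseq"
  have D: "x (D x y) \<noteq> y (D x y)" if "x \<noteq> y" for x y
    unfolding D_def by (rule someI_ex) (use that in blast)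
  \<comment> \<open>the pairs with \<open>x = y\<close> contribute an irrelevant value, which only moves \<open>k\<close> further to the left\<close>
  define k where "k = Min (insert 0 ((\<lambda>(x, y). D x y) ` (F \<times> F)))"
  have "inj_on (\<lambda>x. window x k n) F"
  proof (rule inj_onI, rule ccontr)
    fix x y assume xy: "x \<in> F" "y \<in> F" "window x k n = window y k n" "x \<noteq> y"
    have "k \<le> D x y"
      unfolding k_def using F(1) xy(1,2) by (intro Min_le) auto
    then show False
      using det[of x y k "nat (D x y - k)"] xy F(2) D[OF xy(4)] by auto
  qed
  moreover have "(\<lambda>x. window x k n) ` F \<subseteq> ?W n"
  proof
    fix w assume "w \<in> (\<lambda>x. window x k n) ` F"
    then obtain x where "x \<in> F" "w = window (translate k x) 0 n"
      by (auto simp: window_translate)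
    then show "w \<in> ?W n" using F(2) inv by blast
  qed
  ultimately have "card F \<le> complexity X n"
    unfolding complexity_def using card_inj_on_le finite_windows by blast
  then show False using F(3) by simp
qed

lemma complexity_ge:
  fixes X :: "'a::finite biseq set"
  assumes "\<And>x k. x \<in> X \<Longrightarrow> translate k x \<in> X" "infinite X"
  shows "n \<le> complexity X n"
proof (induction n)
  case (Suc n)
  then show ?case using complexity_strict_mono[OF assms, of n] by simp
qed simp

locale aperiodic_substitution = primitive_substitution +
  assumes inj: "inj \<tau>" and inf: "infinite (subst_shift \<tau>)"
begin

lemma infinite_lang_shift: "infinite lang_shift"
  using inf subst_shift_eq by simp

text \<open>
  A window of length \<open>np + 1\<close> of \<open>T\<^sup>d \<tau>(z)\<close>, \<open>d < p\<close>, is determined by \<open>d\<close> and by the first \<open>n + 1\<close> letters of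
  \<open>z\<close>.
\<close>

lemma complexity_le:
  assumes "finite I" "I \<subseteq> {..<p}" "lang_shift \<subseteq> (\<Union>d\<in>I. prolong d ` lang_shift)"
  shows "complexity lang_shift (n * p + 1) \<le> card I * complexity lang_shift (Suc n)"
proof -
  let ?W = "\<lambda>n. (\<lambda>x. window x 0 n) ` lang_shift"
  define g where "g d w = map (\<lambda>j. \<tau> (w ! ((j + d) div p)) ! ((j + d) mod p)) [0..<n * p + 1]"
    for d and w :: "'a list"
  have "?W (n * p + 1) \<subseteq> (\<lambda>(d, w). g d w) ` (I \<times> ?W (Suc n))"
  proof
    fix v assume "v \<in> ?W (n * p + 1)"
    then obtain x where x: "x \<in> lang_shift" "v = window x 0 (n * p + 1)" by blast
    then obtain d z where "d \<in> I" "z \<in> lang_shift" "x = prolong d z"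
      using assms(3) by blast
    with x have dz: "d \<in> I" "z \<in> lang_shift" "v = window (prolong d z) 0 (n * p + 1)"
      by simp_all
    have "v = g d (window z 0 (Suc n))"
    proof (rule nth_equalityI)
      fix j assume "j < length v"
      then have j: "j < n * p + 1" using dz(3) by simp
      have "d < p" using dz(1) assms(2) by auto
      then have "(j + d) div p < Suc n"
        using j by (intro less_mult_imp_div_less) simp
      then show "v ! j = g d (window z 0 (Suc n)) ! j"
        using j by (simp add: dz(3) g_def prolong_apply nth_append nat_mod_as_int zdiv_int del: upt_Suc)
    qed (simp add: dz(3) g_def)
    then show "v \<in> (\<lambda>(d, w). g d w) ` (I \<times> ?W (Suc n))"
      using dz(1,2) by auto
  qed
  then have "card (?W (n * p + 1)) \<le> card (I \<times> ?W (Suc n))"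
    by (rule surj_card_le[rotated]) (simp add: assms(1) finite_windows)
  then show ?thesis by (simp add: complexity_def card_cartesian_product)
qed

text \<open>
  If two of the images met, one of them could be dropped from the cover by
  \<open>prolong_images_eq_or_disjoint\<close>.  Iterating \<open>complexity_le\<close> with \<open>p - 1\<close> images along the
  lengths \<open>p\<^sup>k + 1\<close>, each of which is mapped to the next by
  \<open>n \<mapsto> (n - 1) p + 1\<close>, bounds the complexity by a multiple of
  \<open>(p - 1)\<^sup>k\<close>, below the linear growth of an infinite shift-invariant set.
\<close>

lemma phase_unique:
  assumes "prolong d z = prolong e w" "z \<in> lang_shift" "w \<in> lang_shift" "d < p" "e < p"
  shows "d = e"
proof (rule ccontr)
  assume "d \<noteq> e"
  let ?I = "{..<p} - {d}"
  have "lang_shift \<subseteq> (\<Union>d\<in>?I. prolong d ` lang_shift)"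
  proof
    fix x assume "x \<in> lang_shift"
    then obtain c v where c: "c < p" "v \<in> lang_shift" "x = prolong c v"
      using lang_shift_cover by blast
    show "x \<in> (\<Union>d\<in>?I. prolong d ` lang_shift)"
    proof (cases "c = d")
      case True
      then have "x \<in> prolong e ` lang_shift"
        using prolong_images_eq_or_disjoint[OF assms] c by blast
      then show ?thesis using \<open>d \<noteq> e\<close> assms(5) by blast
    qed (use c in blast)
  qed
  then have step: "complexity lang_shift (n * p + 1) \<le> (p - 1) * complexity lang_shift (Suc n)" for n
    using complexity_le[of ?I n] assms(4) by simp
  have bound: "complexity lang_shift (p ^ k + 1) \<le> (p - 1) ^ k * complexity lang_shift 2" for k
  proof (induction k)
    case 0
    then show ?case by (simp add: numeral_2_eq_2)
  next
    case (Suc k)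
    have "complexity lang_shift (p ^ Suc k + 1) \<le> (p - 1) * complexity lang_shift (p ^ k + 1)"
      using step[of "p ^ k"] by (simp add: mult.commute)
    also have "\<dots> \<le> (p - 1) * ((p - 1) ^ k * complexity lang_shift 2)"
      using Suc.IH by (rule mult_le_mono2)
    finally show ?case by (simp add: mult.assoc)
  qed
  define c where "c = real (complexity lang_shift 2)"
  have "p ^ k \<le> (p - 1) ^ k * complexity lang_shift 2" for k
    using bound[of k] complexity_ge[OF translate_in_lang_shift infinite_lang_shift, of "p ^ k + 1"]
    by simp
  then have le: "real p ^ k \<le> real (p - 1) ^ k * c" for k
    unfolding c_def by (metis of_nat_le_iff of_nat_mult of_nat_power)
  define q where "q = real p / real (p - 1)"
  have q: "q > 1" using p_ge_2 by (simp add: q_def)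
  obtain k where "c < q ^ k" using real_arch_pow[OF q] by blast
  moreover have "q ^ k \<le> c"
    using le[of k] p_ge_2 by (simp add: q_def power_divide divide_le_eq mult.commute)
  ultimately show False by simp
qed

end

section \<open>Expansions\<close>

context aperiodic_substitution
begin

text \<open>
  The first step of the expansion: \<open>phase x\<close> is \<open>\<delta>\<^sub>0\<close> and \<open>parent x\<close> is \<open>x\<^sup>(\<^sup>1\<^sup>)\<close>.  By \<open>phase_unique\<close>
  there is only one choice, and iterating it gives the whole expansion.
\<close>

definition phase :: "'a biseq \<Rightarrow> nat" where
  "phase x = (SOME d. d < p \<and> (\<exists>z\<in>lang_shift. x = prolong d z))"

definition parent :: "'a biseq \<Rightarrow> 'a biseq" where
  "parent x = (SOME z. z \<in> lang_shift \<and> x = prolong (phase x) z)"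

lemma
  assumes "x \<in> lang_shift"
  shows phase_less: "phase x < p"
    and parent_in: "parent x \<in> lang_shift"
    and prolong_phase_parent: "prolong (phase x) (parent x) = x"
proof -
  have "\<exists>d. d < p \<and> (\<exists>z\<in>lang_shift. x = prolong d z)"
    using lang_shift_cover[OF assms] by blast
  then have *: "phase x < p \<and> (\<exists>z\<in>lang_shift. x = prolong (phase x) z)"
    unfolding phase_def by (rule someI_ex)
  then have "\<exists>z. z \<in> lang_shift \<and> x = prolong (phase x) z" by blast
  then have "parent x \<in> lang_shift \<and> x = prolong (phase x) (parent x)"
    unfolding parent_def by (rule someI_ex)
  then show "phase x < p" "parent x \<in> lang_shift" "prolong (phase x) (parent x) = x"
    using * by simp_all
qed

lemma
  assumes "z \<in> lang_shift" "d < p"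
  shows phase_prolong: "phase (prolong d z) = d"
    and parent_prolong: "parent (prolong d z) = z"
proof -
  let ?x = "prolong d z"
  have x: "?x \<in> lang_shift" by (rule prolong_in_lang_shift[OF assms(1)])
  show d: "phase ?x = d"
    by (rule phase_unique[OF prolong_phase_parent[OF x]])
      (use x assms in \<open>simp_all add: phase_less parent_in\<close>)
  show "parent ?x = z"
    using prolong_phase_parent[OF x] unfolding d by (rule prolong_inj[OF inj])
qed

lemma funpow_parent_in: "x \<in> lang_shift \<Longrightarrow> (parent ^^ i) x \<in> lang_shift"
  by (induction i) (simp_all add: parent_in)

lemma is_expansion_iff:
  assumes "x \<in> lang_shift"
  shows "is_expansion p \<tau> x (z, \<delta>) \<longleftrightarrow>
    z = (\<lambda>i. (parent ^^ i) x) \<and> \<delta> = (\<lambda>i. phase ((parent ^^ i) x))"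
proof
  assume *: "is_expansion p \<tau> x (z, \<delta>)"
  have z0: "z 0 = x" and zX: "z i \<in> lang_shift" and d: "\<delta> i < p"
    and zi: "z i = prolong (\<delta> i) (z (Suc i))" for i
  proof -
    have a: "z 0 = x \<and> z i \<in> lang_shift \<and> \<delta> i \<in> {0..p - 1} \<and>
        z i = (shift ^^ \<delta> i) (subst_seq \<tau> (z (Suc i)))"
      using * unfolding is_expansion_def subst_shift_eq by blast
    then show "z 0 = x" "z i \<in> lang_shift" "z i = prolong (\<delta> i) (z (Suc i))"
      unfolding prolong_eq_shift by blast+
    show "\<delta> i < p" using a p_pos by auto
  qed
  have "z (Suc i) = parent (z i)" "\<delta> i = phase (z i)" for i
    by (simp_all add: zi[of i] phase_prolong[OF zX d] parent_prolong[OF zX d])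
  moreover from this(1) have "z i = (parent ^^ i) x" for i
    by (induction i) (simp_all add: z0)
  ultimately show "z = (\<lambda>i. (parent ^^ i) x) \<and> \<delta> = (\<lambda>i. phase ((parent ^^ i) x))"
    by (simp add: fun_eq_iff)
next
  assume "z = (\<lambda>i. (parent ^^ i) x) \<and> \<delta> = (\<lambda>i. phase ((parent ^^ i) x))"
  then have z: "z = (\<lambda>i. (parent ^^ i) x)" and d: "\<delta> = (\<lambda>i. phase ((parent ^^ i) x))" by simp_all
  have "phase ((parent ^^ i) x) \<le> p - 1" for i
    using phase_less[OF funpow_parent_in[OF assms], of i] by simp
  then show "is_expansion p \<tau> x (z, \<delta>)"
    unfolding is_expansion_def subst_shift_eq z d
    by (simp add: funpow_parent_in[OF assms] prolong_phase_parent[OF funpow_parent_in[OF assms]] parent_in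
        flip: prolong_eq_shift)
qed

lemma
  assumes "x \<in> lang_shift"
  shows desubst_eq: "desubst p \<tau> x i = (parent ^^ i) x"
    and digits_eq: "digits p \<tau> x i = phase ((parent ^^ i) x)"
proof -
  have "expansion p \<tau> x = ((\<lambda>i. (parent ^^ i) x), (\<lambda>i. phase ((parent ^^ i) x)))"
    unfolding expansion_def
  proof (rule the_equality)
    fix e assume "is_expansion p \<tau> x e"
    then show "e = ((\<lambda>i. (parent ^^ i) x), (\<lambda>i. phase ((parent ^^ i) x)))"
      using is_expansion_iff[OF assms, of "fst e" "snd e"] by (simp add: prod_eq_iff)
  qed (simp add: is_expansion_iff[OF assms])
  then show "desubst p \<tau> x i = (parent ^^ i) x" "digits p \<tau> x i = phase ((parent ^^ i) x)"
    by (simp_all add: desubst_def digits_def)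
qed

lemma desubst_0: "x \<in> lang_shift \<Longrightarrow> desubst p \<tau> x 0 = x"
  by (simp add: desubst_eq)

lemma desubst_in: "x \<in> lang_shift \<Longrightarrow> desubst p \<tau> x i \<in> lang_shift"
  by (simp add: desubst_eq funpow_parent_in)

lemma digits_less: "x \<in> lang_shift \<Longrightarrow> digits p \<tau> x i < p"
  by (simp add: digits_eq phase_less funpow_parent_in)

lemma desubst_prolong:
  "x \<in> lang_shift \<Longrightarrow> desubst p \<tau> x i = prolong (digits p \<tau> x i) (desubst p \<tau> x (Suc i))"
  by (simp add: digits_eq desubst_eq prolong_phase_parent funpow_parent_in)

lemma desubst_apply:
  "x \<in> lang_shift \<Longrightarrow> desubst p \<tau> x i n =
     \<tau> (desubst p \<tau> x (Suc i) ((n + int (digits p \<tau> x i)) div int p))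
       ! nat ((n + int (digits p \<tau> x i)) mod int p)"
  unfolding desubst_prolong[of x i] prolong_apply by simp

lemma mem_I_plus: "i \<in> I_plus p \<tau> x \<longleftrightarrow> digits p \<tau> x i < p - 1"
  using p_pos by (auto simp: I_plus_def right_part_def)

text \<open>
  Translation acts on the first digit like addition in the \<open>p\<close>-adic odometer, the carry being passed on as
  a translation of the desubstituted point.
\<close>

lemma phase_translate:
  assumes "x \<in> lang_shift"
  shows "phase (translate k x) = nat ((k + int (phase x)) mod int p)"
    and "parent (translate k x) = translate ((k + int (phase x)) div int p) (parent x)"
proof -
  let ?d = "nat ((k + int (phase x)) mod int p)" and ?l = "(k + int (phase x)) div int p"
  have d: "int ?d = (k + int (phase x)) mod int p" "?d < p"
    using p_pos by (simp_all add: nat_less_iff)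
  have "translate k (prolong (phase x) (parent x)) = prolong ?d (translate ?l (parent x))"
    by (rule translate_prolong) (simp only: d div_mult_mod_eq)
  then have *: "translate k x = prolong ?d (translate ?l (parent x))"
    by (simp only: prolong_phase_parent[OF assms])
  show "phase (translate k x) = ?d" "parent (translate k x) = translate ?l (parent x)"
    unfolding * using d(2) translate_in_lang_shift[OF parent_in[OF assms]]
    by (simp_all only: phase_prolong parent_prolong)
qed

text \<open>
  Here \<open>offset \<delta> i\<close> is the position of the coordinate \<open>0\<close> inside its block of level \<open>i\<close>, and \<open>block \<delta> i n\<close>
  is the index of the block of level \<open>i\<close> that contains the coordinate \<open>n\<close>, for points with digits \<open>\<delta>\<close>.
\<close>

definition offset :: "(nat \<Rightarrow> nat) \<Rightarrow> nat \<Rightarrow> int" where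
  "offset \<delta> i = (\<Sum>j<i. int (\<delta> j) * int p ^ j)"

definition block :: "(nat \<Rightarrow> nat) \<Rightarrow> nat \<Rightarrow> int \<Rightarrow> int" where
  "block \<delta> i n = (n + offset \<delta> i) div int p ^ i"

lemma block_0 [simp]: "block \<delta> 0 n = n"
  by (simp add: block_def offset_def)

lemma block_Suc: "block \<delta> (Suc i) n = (block \<delta> i n + int (\<delta> i)) div int p"
proof -
  have "(n + offset \<delta> (Suc i)) div (int p ^ i) = (n + offset \<delta> i) div int p ^ i + int (\<delta> i)"
    using p_pos div_mult_self1[of "int p ^ i" "n + offset \<delta> i" "int (\<delta> i)"]
    by (simp add: offset_def add.assoc)
  then show ?thesis
    unfolding block_def power_Suc2 using p_pos by (simp add: zdiv_zmult2_eq)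
qed

lemma block_mono: "n \<le> m \<Longrightarrow> block \<delta> i n \<le> block \<delta> i m"
  unfolding block_def using p_pos by (intro zdiv_mono1) simp_all

lemma offset_nonneg: "0 \<le> offset \<delta> i"
  unfolding offset_def by (intro sum_nonneg) simp

lemma offset_less: "(\<And>j. \<delta> j < p) \<Longrightarrow> offset \<delta> i < int p ^ i"
proof (induction i)
  case (Suc i)
  have "int (\<delta> i) * int p ^ i \<le> (int p - 1) * int p ^ i"
    using Suc.prems[of i] by (intro mult_right_mono) simp_all
  then show ?case using Suc.IH[OF Suc.prems] by (simp add: offset_def algebra_simps)
qed (simp add: offset_def)

lemma block_nonneg: "0 \<le> n \<Longrightarrow> 0 \<le> block \<delta> i n"
  unfolding block_def using offset_nonneg[of \<delta> i] p_pos
  by (intro pos_imp_zdiv_nonneg_iff[THEN iffD2]) simp_all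

lemma block_pos:
  assumes "int p ^ i \<le> n"
  shows "1 \<le> block \<delta> i n"
proof -
  have "int p ^ i div int p ^ i \<le> (n + offset \<delta> i) div int p ^ i"
    using assms offset_nonneg[of \<delta> i] p_pos by (intro zdiv_mono1) simp_all
  then show ?thesis using p_pos by (simp add: block_def)
qed

lemma block_eq_0_mono:
  assumes "\<And>j. \<delta> j < p" "block \<delta> i n = 0" "i \<le> k"
  shows "block \<delta> k n = 0"
  using assms(3)
proof (induction k rule: dec_induct)
  case (step k)
  then show ?case using assms(1)[of k] by (simp add: block_Suc)
qed (rule assms(2))

text \<open>
  The number of coordinates \<open>n \<ge> 0\<close> in the block of index \<open>0\<close> is \<open>p\<^sup>i - offset \<delta> i\<close>.  It never decreases
  with \<open>i\<close>, and it grows whenever \<open>\<delta>\<^sub>i < p - 1\<close>.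
\<close>

lemma block_eventually_0:
  assumes \<delta>: "\<And>j. \<delta> j < p" and inf: "infinite {i. \<delta> i < p - 1}" and "0 \<le> n"
  shows "\<exists>I. \<forall>i\<ge>I. block \<delta> i n = 0"
proof -
  have "\<exists>i. int m + offset \<delta> i < int p ^ i" for m :: nat
  proof (induction m)
    case 0
    then show ?case using offset_less[of \<delta>, OF \<delta>] by auto
  next
    case (Suc m)
    then obtain i where i: "int m + offset \<delta> i < int p ^ i" by blast
    have stay: "int m + offset \<delta> k < int p ^ k" if "i \<le> k" for k
      using that
    proof (induction k rule: dec_induct)
      case (step k)
      have "int (\<delta> k) * int p ^ k \<le> (int p - 1) * int p ^ k"
        using \<delta>[of k] by (intro mult_right_mono) simp_all
      then show ?case using step.IH by (simp add: offset_def algebra_simps)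
    qed (rule i)
    obtain k where k: "k > i" "\<delta> k < p - 1"
      using inf unfolding infinite_nat_iff_unbounded by auto
    have "(int (\<delta> k) + 1) * int p ^ k \<le> (int p - 1) * int p ^ k"
      using k(2) by (intro mult_right_mono) simp_all
    moreover have "int p ^ k \<ge> 1" using p_pos by simp
    ultimately have "int (Suc m) + offset \<delta> (Suc k) < int p ^ Suc k"
      using stay[of k] k(1) by (simp add: offset_def algebra_simps)
    then show ?case by blast
  qed
  from this[of "nat n"] obtain I where "n + offset \<delta> I < int p ^ I"
    using \<open>0 \<le> n\<close> by auto
  then have "block \<delta> I n = 0"
    unfolding block_def using \<open>0 \<le> n\<close> offset_nonneg[of \<delta> I]
    by (intro div_pos_pos_trivial) simp_all
  then show ?thesis using block_eq_0_mono[of \<delta>, OF \<delta>] by blast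
qed

text \<open>
  Translating a point by \<open>k\<close> translates its \<open>i\<close>-th desubstitution by the index of the block of \<open>k\<close>,
  and the first digit of that translate is known from \<open>phase_translate\<close>.
\<close>

lemma digits_translate:
  assumes "x \<in> lang_shift"
  shows "digits p \<tau> (translate k x) i =
    nat ((block (digits p \<tau> x) i k + int (digits p \<tau> x i)) mod int p)"
proof -
  have x: "translate k x \<in> lang_shift" by (rule translate_in_lang_shift[OF assms])
  have *: "desubst p \<tau> (translate k x) i = translate (block (digits p \<tau> x) i k) (desubst p \<tau> x i)" for i
  proof (induction i)
    case 0
    show ?case by (simp only: block_0 desubst_0[OF x] desubst_0[OF assms])
  next
    case (Suc i)
    have "desubst p \<tau> (translate k x) (Suc i) = parent (desubst p \<tau> (translate k x) i)"
      by (simp add: desubst_eq x)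
    also have "\<dots> = translate (block (digits p \<tau> x) (Suc i) k) (parent (desubst p \<tau> x i))"
      unfolding Suc.IH phase_translate(2)[OF desubst_in[OF assms]] block_Suc
      by (simp only: digits_eq[OF assms] desubst_eq[OF assms])
    also have "parent (desubst p \<tau> x i) = desubst p \<tau> x (Suc i)"
      by (simp add: desubst_eq assms)
    finally show ?case .
  qed
  have "digits p \<tau> (translate k x) i = phase (desubst p \<tau> (translate k x) i)"
    by (simp add: digits_eq desubst_eq x)
  then show "digits p \<tau> (translate k x) i =
      nat ((block (digits p \<tau> x) i k + int (digits p \<tau> x i)) mod int p)"
    unfolding * phase_translate(1)[OF desubst_in[OF assms]]
    by (simp add: digits_eq desubst_eq assms)
qed

lemma digits_translate_cong:
  assumes "x \<in> lang_shift" "y \<in> lang_shift" "digits p \<tau> x = digits p \<tau> y"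
  shows "digits p \<tau> (translate k x) = digits p \<tau> (translate k y)"
  by (rule ext) (simp only: digits_translate[OF assms(1)] digits_translate[OF assms(2)] assms(3))

lemma infinite_I_plus_translate:
  assumes x: "x \<in> lang_shift" and inf: "infinite (I_plus p \<tau> x)" and k: "0 \<le> k"
  shows "infinite (I_plus p \<tau> (translate k x))"
proof -
  have "I_plus p \<tau> x = {i. digits p \<tau> x i < p - 1}" using mem_I_plus by blast
  then obtain I where I: "\<And>i. i \<ge> I \<Longrightarrow> block (digits p \<tau> x) i k = 0"
    using block_eventually_0[of "digits p \<tau> x", OF digits_less[OF x] _ k] inf by auto
  have "digits p \<tau> (translate k x) i = digits p \<tau> x i" if "i \<ge> I" for i
    using digits_translate[OF x, of k i] I[OF that] digits_less[OF x, of i] by simp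
  then have "I_plus p \<tau> x \<subseteq> I_plus p \<tau> (translate k x) \<union> {..<I}"
    unfolding mem_I_plus subset_iff by (metis UnCI lessThan_iff mem_I_plus not_le)
  then show ?thesis using inf finite_subset by blast
qed

text \<open>
  The word \<open>x\<^sub>0 s\<^sub>0 \<tau>(s\<^sub>1) \<dots> \<tau>\<^sup>i(s\<^sub>i)\<close> is the part of the block of level \<open>i + 1\<close> around \<open>0\<close> that starts at \<open>0\<close>.
\<close>

lemma length_right_word:
  assumes "x \<in> lang_shift"
  shows "int (length (right_word p \<tau> i x)) = int p ^ Suc i - offset (digits p \<tau> x) (Suc i)"
proof (induction i)
  have len: "int (length (right_part p \<tau> i x)) = int p - 1 - int (digits p \<tau> x i)" for i
    using digits_less[OF assms, of i] by (simp add: right_part_def)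
  {
    case 0
    show ?case using len[of 0] by (simp add: right_word_def offset_def)
  next
    case (Suc i)
    have "int (length (right_word p \<tau> (Suc i) x)) =
        int (length (right_word p \<tau> i x)) + int p ^ Suc i * int (length (right_part p \<tau> (Suc i) x))"
      by (simp add: right_word_def length_funpow_subst_word length_subst_word)
    also have "\<dots> = int p ^ Suc (Suc i) - offset (digits p \<tau> x) (Suc (Suc i))"
      unfolding Suc.IH len by (simp add: offset_def algebra_simps)
    finally show ?case .
  }
qed

text \<open>
  When \<open>\<delta>\<^sub>i = p - 1\<close> for all \<open>i \<ge> M\<close>, the blocks of index \<open>0\<close> stop growing to the right at
  \<open>k\<^sup>+ = p\<^sup>m - offset \<delta> m\<close>, for every \<open>m \<ge> M\<close>.  So blocks of all levels start at the coordinate \<open>k\<^sup>+\<close>, which means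
  that the translate by \<open>k\<^sup>+\<close> has the digits \<open>0\<close>.
\<close>

lemma k_plus_finite:
  assumes x: "x \<in> lang_shift" and fin: "finite (I_plus p \<tau> x)"
  obtains k where "k_plus p \<tau> x = enat k" "\<And>i. digits p \<tau> (translate (int k) x) i = 0"
proof -
  let ?\<delta> = "digits p \<tau> x"
  define room where "room i = nat (int p ^ i - offset ?\<delta> i)" for i
  have room: "int (room i) = int p ^ i - offset ?\<delta> i" for i
    using offset_less[of ?\<delta> i, OF digits_less[OF x]] by (simp add: room_def)
  have room_Suc: "int (room (Suc i)) = int (room i) + (int p - 1 - int (?\<delta> i)) * int p ^ i" for i
    unfolding room by (simp add: offset_def algebra_simps)
  have "room i \<le> room (Suc i)" for i
  proof -
    have "0 \<le> (int p - 1 - int (?\<delta> i)) * int p ^ i"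
      using digits_less[OF x, of i] by (intro mult_nonneg_nonneg) simp_all
    then show ?thesis using room_Suc[of i] by linarith
  qed
  then have room_mono: "i \<le> j \<Longrightarrow> room i \<le> room j" for i j
    by (rule lift_Suc_mono_le)
  have stay: "room (Suc i) = room i" if "i \<notin> I_plus p \<tau> x" for i
  proof -
    have "int (?\<delta> i) = int p - 1"
      using that digits_less[OF x, of i] p_pos unfolding mem_I_plus by linarith
    then show ?thesis using room_Suc[of i] by simp
  qed
  obtain M where M: "k_plus p \<tau> x = enat (room M)" "\<And>i. i \<ge> M \<Longrightarrow> i \<notin> I_plus p \<tau> x"
  proof (cases "I_plus p \<tau> x = {}")
    case True
    then show ?thesis using that[of 0] by (simp add: k_plus_def room_def offset_def one_enat_def)
  next
    case False
    define M where "M = Max (I_plus p \<tau> x)"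
    have Max: "M \<in> I_plus p \<tau> x" "\<And>i. i \<in> I_plus p \<tau> x \<Longrightarrow> i \<le> M"
      using fin False by (simp_all add: M_def)
    have len: "length (right_word p \<tau> i x) = room (Suc i)" for i
      using length_right_word[OF x, of i] room[of "Suc i"] by linarith
    have "k_plus p \<tau> x = (SUP i\<in>I_plus p \<tau> x. enat (room (Suc i)))"
      unfolding k_plus_def len using False by simp
    also have "\<dots> = enat (room (Suc M))"
    proof (rule antisym)
      show "(SUP i\<in>I_plus p \<tau> x. enat (room (Suc i))) \<le> enat (room (Suc M))"
        by (rule SUP_least) (use Max(2) room_mono in simp)
    qed (rule SUP_upper[OF Max(1)])
    finally show ?thesis using that[of "Suc M"] Max(2) by fastforce
  qed
  have const: "room i = room M" if "i \<ge> M" for i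
    using that
  proof (induction i rule: dec_induct)
    case (step i)
    then show ?case using stay[OF M(2)] by simp
  qed simp
  have "digits p \<tau> (translate (int (room M)) x) i = 0" for i
  proof -
    let ?k = "int (room M)"
    \<comment> \<open>any \<open>m \<ge> M\<close> computes \<open>k\<^sup>+\<close>; taking it above \<open>i\<close> makes \<open>k\<^sup>+ + P\<^bsub>i+1\<^esub>\<close> a multiple of \<open>p\<^bsup>i+1\<^esup>\<close>\<close>
    define m where "m = max M (Suc i)"
    have k: "?k = int p ^ m - offset ?\<delta> m"
      using const[of m] room[of m] by (simp add: m_def)
    have "int p ^ Suc i dvd (\<Sum>j\<in>{Suc i..<m}. int (?\<delta> j) * int p ^ j)"
      by (intro dvd_sum dvd_mult le_imp_power_dvd) simp
    moreover have "offset ?\<delta> m = offset ?\<delta> (Suc i) + (\<Sum>j\<in>{Suc i..<m}. int (?\<delta> j) * int p ^ j)"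
    proof -
      have *: "{..<m} = {..<Suc i} \<union> {Suc i..<m}" by (auto simp: m_def)
      show ?thesis unfolding offset_def * by (rule sum.union_disjoint) auto
    qed
    moreover have "int p ^ Suc i dvd int p ^ m"
      by (intro le_imp_power_dvd) (simp add: m_def)
    ultimately have "int p ^ Suc i dvd ?k + offset ?\<delta> (Suc i)"
      unfolding k by (simp add: dvd_diff)
    then obtain c where c: "?k + offset ?\<delta> (Suc i) = int p ^ Suc i * c" ..
    have "block ?\<delta> i ?k + int (?\<delta> i) = (?k + offset ?\<delta> (Suc i)) div int p ^ i"
      using div_mult_self1[of "int p ^ i" "?k + offset ?\<delta> i" "int (?\<delta> i)"] p_pos
      by (simp add: block_def offset_def add.assoc)
    also have "\<dots> = int p * c"
      unfolding c using p_pos by simp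
    finally show ?thesis using digits_translate[OF x, of ?k i] by simp
  qed
  then show ?thesis using that[OF M(1)] by blast
qed

text \<open>
  Every claim about the behaviour far to the right can thus be reduced to infinite \<open>I\<^sup>+\<close>.
\<close>

lemma ex_translate_infinite_I_plus:
  assumes "x \<in> lang_shift"
  shows "\<exists>k\<ge>0. infinite (I_plus p \<tau> (translate k x))"
proof (cases "finite (I_plus p \<tau> x)")
  case True
  obtain k where "\<And>i. digits p \<tau> (translate (int k) x) i = 0"
    using k_plus_finite[OF assms True] by metis
  then have "I_plus p \<tau> (translate (int k) x) = UNIV"
    using mem_I_plus p_ge_2 by auto
  then have "infinite (I_plus p \<tau> (translate (int k) x))" by simp
  then show ?thesis by (intro exI[of _ "int k"]) simp
next
  case False
  then show ?thesis by (intro exI[of _ 0]) simp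
qed

end

section \<open>Proximal points have the same digits\<close>

context aperiodic_substitution
begin

text \<open>
  The sets \<open>T\<^sup>d \<tau>(X)\<close> with \<open>d\<close> different from the phase of \<open>x\<close> have a closed union that avoids \<open>x\<close>, hence
  avoids a window of \<open>x\<close>.  Compactness makes the window uniform.
\<close>

lemma phase_locally_constant:
  "\<exists>m. \<forall>u\<in>lang_shift. \<forall>v\<in>lang_shift. agree m u v \<longrightarrow> phase u = phase v"
proof (rule ccontr)
  have loc: "\<exists>m. \<forall>v\<in>lang_shift. agree m x v \<longrightarrow> phase v = phase x" if x: "x \<in> lang_shift" for x
  proof (rule ccontr)
    assume neg: "\<not> ?thesis"
    let ?U = "\<Union>d\<in>{..<p} - {phase x}. prolong d ` lang_shift"
    have "closedin full_shift_topology ?U"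
      by (intro closedin_Union) (auto intro: closedin_prolong_image[OF closedin_lang_shift])
    then have "x \<in> ?U"
    proof (rule closedin_full_shiftD)
      fix m
      obtain v where v: "v \<in> lang_shift" "agree m x v" "phase v \<noteq> phase x"
        using neg by blast
      have "v \<in> ?U"
        using v(3) phase_less[OF v(1)] parent_in[OF v(1)] prolong_phase_parent[OF v(1), symmetric]
        by (intro UN_I[of "phase v"]) auto
      then show "\<exists>u\<in>?U. agree m x u" using v(2) by blast
    qed
    then obtain d z where "d < p" "d \<noteq> phase x" "z \<in> lang_shift" "x = prolong d z" by blast
    then show False using phase_prolong[of z d] by simp
  qed
  assume "\<not> ?thesis"
  then have "\<forall>m. \<exists>u\<in>lang_shift. \<exists>v\<in>lang_shift. agree m u v \<and> phase u \<noteq> phase v" by simp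
  then obtain u v where uv: "\<And>m. u m \<in> lang_shift" "\<And>m. v m \<in> lang_shift"
    "\<And>m. agree m (u m) (v m)" "\<And>m. phase (u m) \<noteq> phase (v m)"
    by metis
  obtain x where x: "\<And>m N. \<exists>n\<ge>N. agree m x (u n)"
    using ex_cluster_point[of u] by metis
  have "x \<in> lang_shift"
    by (rule closedin_full_shiftD[OF closedin_lang_shift]) (use x uv(1) in blast)
  then obtain m where m: "\<And>w. w \<in> lang_shift \<Longrightarrow> agree m x w \<Longrightarrow> phase w = phase x"
    using loc by blast
  obtain n where n: "n \<ge> m" "agree m x (u n)" using x by blast
  have "agree m x (v n)" by (rule agree_trans[OF n(2) agree_mono[OF uv(3) n(1)]])
  then show False using m[OF uv(1) n(2)] m[OF uv(2)] uv(4)[of n] by simp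
qed

lemma equal_on_windows_phase:
  assumes x: "x \<in> lang_shift" and y: "y \<in> lang_shift" and prox: "equal_on_windows x y"
  shows "phase x = phase y"
proof -
  obtain m where m: "\<And>u v. u \<in> lang_shift \<Longrightarrow> v \<in> lang_shift \<Longrightarrow> agree m u v \<Longrightarrow> phase u = phase v"
    using phase_locally_constant by blast
  obtain n where "agree m (translate n x) (translate n y)"
    using prox unfolding equal_on_windows_def by blast
  then have "phase (translate n x) = phase (translate n y)"
    by (intro m translate_in_lang_shift x y)
  then have eq: "(n + int (phase x)) mod int p = (n + int (phase y)) mod int p"
    unfolding phase_translate(1)[OF x] phase_translate(1)[OF y]
    using pos_mod_sign[OF p_pos(2)] eq_nat_nat_iff by blast
  have "int (phase x) mod int p = int (phase y) mod int p"
    using mod_diff_cong[OF eq refl[of "n mod int p"]] by (simp only: add_diff_cancel_left')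
  moreover have "int (phase x) mod int p = int (phase x)" "int (phase y) mod int p = int (phase y)"
    using phase_less[OF x] phase_less[OF y] by (simp_all add: mod_pos_pos_trivial)
  ultimately show ?thesis by linarith
qed

text \<open>
  A common window of \<open>x\<close> and \<open>y\<close> that covers \<open>m + 1\<close> blocks to either side shows \<open>\<tau>\<close> of the letters of the
  desubstituted points in a window of radius \<open>m\<close>, and \<open>\<tau>\<close> is one-to-one.
\<close>

lemma equal_on_windows_parent:
  assumes x: "x \<in> lang_shift" and y: "y \<in> lang_shift" and prox: "equal_on_windows x y"
  shows "equal_on_windows (parent x) (parent y)"
  unfolding equal_on_windows_def
proof (intro allI)
  fix m :: nat and N :: int
  define d where "d = phase x"
  have dy: "phase y = d" using equal_on_windows_phase[OF assms] by (simp add: d_def)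
  obtain n where n: "n \<ge> N * int p" "agree ((m + 1) * p) (translate n x) (translate n y)"
    using prox unfolding equal_on_windows_def by blast
  define l where "l = (n + int d) div int p"
  define s where "s = (n + int d) mod int p"
  have ls: "n + int d = l * int p + s" by (simp add: l_def s_def)
  have s: "0 \<le> s" "s < int p" using p_pos by (simp_all add: s_def)
  have "N = N * int p div int p" using p_pos by simp
  also have "\<dots> \<le> l" unfolding l_def using n(1) p_pos by (intro zdiv_mono1) simp_all
  finally have "N \<le> l" .
  moreover have "agree m (translate l (parent x)) (translate l (parent y))"
    unfolding agree_def
  proof (intro allI impI)
    fix i assume i: "\<bar>i\<bar> \<le> int m"
    have "\<tau> (parent x (i + l)) = \<tau> (parent y (i + l))"
    proof (rule nth_equalityI)
      fix r assume "r < length (\<tau> (parent x (i + l)))"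
      then have r: "r < p" by simp
      define k where "k = i * int p + int r - s"
      have letter: "prolong d z (k + n) = \<tau> (z (i + l)) ! r" for z
      proof -
        have "k + n + int d = int r + (i + l) * int p"
          using ls by (simp add: k_def algebra_simps)
        then show ?thesis unfolding prolong_apply using r p_pos by simp
      qed
      have "\<bar>i * int p\<bar> \<le> int m * int p"
        unfolding abs_mult using i by (intro mult_mono) simp_all
      then have "\<bar>k\<bar> \<le> int ((m + 1) * p)"
        unfolding k_def using r s by (simp add: algebra_simps)
      then have "x (k + n) = y (k + n)" using n(2) unfolding agree_def by simp
      moreover have "prolong d (parent x) = x" "prolong d (parent y) = y"
        using prolong_phase_parent[OF x] prolong_phase_parent[OF y] by (simp_all add: dy flip: d_def)
      ultimately show "\<tau> (parent x (i + l)) ! r = \<tau> (parent y (i + l)) ! r"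
        using letter[of "parent x"] letter[of "parent y"] by simp
    qed simp
    then show "translate l (parent x) i = translate l (parent y) i"
      using inj by (simp add: inj_eq)
  qed
  ultimately show "\<exists>n\<ge>N. agree m (translate n (parent x)) (translate n (parent y))" by blast
qed

lemma equal_on_windows_digits:
  assumes x: "x \<in> lang_shift" and y: "y \<in> lang_shift" and prox: "equal_on_windows x y"
  shows "digits p \<tau> x = digits p \<tau> y"
proof
  fix i
  have "equal_on_windows ((parent ^^ i) x) ((parent ^^ i) y)"
    by (induction i) (simp_all add: prox equal_on_windows_parent funpow_parent_in x y)
  then have "phase ((parent ^^ i) x) = phase ((parent ^^ i) y)"
    by (intro equal_on_windows_phase funpow_parent_in x y)
  then show "digits p \<tau> x i = digits p \<tau> y i"
    unfolding digits_eq[OF x] digits_eq[OF y] .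
qed

end

section \<open>Pairs with the same digits\<close>

locale same_digits_pair = aperiodic_substitution +
  fixes x y :: "'a biseq"
  assumes x_in: "x \<in> lang_shift" and y_in: "y \<in> lang_shift"
    and same_digits: "digits p \<tau> x = digits p \<tau> y"
begin

abbreviation \<delta> :: "nat \<Rightarrow> nat" where "\<delta> \<equiv> digits p \<tau> x"

definition eq_at :: "nat \<Rightarrow> int \<Rightarrow> bool" where
  "eq_at i n \<longleftrightarrow> desubst p \<tau> x i n = desubst p \<tau> y i n"

lemma \<delta>_less: "\<delta> i < p"
  by (rule digits_less[OF x_in])

lemma eq_at_0: "eq_at 0 n \<longleftrightarrow> x n = y n"
  by (simp add: eq_at_def desubst_0 x_in y_in)

lemma eq_at_letters:
  "eq_at i n \<longleftrightarrow>
     \<tau> (desubst p \<tau> x (Suc i) ((n + int (\<delta> i)) div int p)) ! nat ((n + int (\<delta> i)) mod int p) =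
     \<tau> (desubst p \<tau> y (Suc i) ((n + int (\<delta> i)) div int p)) ! nat ((n + int (\<delta> i)) mod int p)"
  unfolding eq_at_def desubst_apply[OF x_in, of i n] desubst_apply[OF y_in, of i n] same_digits ..

text \<open>
  Agreement passes from a letter to all letters of its image, so along the blocks it is inherited by lower
  levels, and disagreement at the index \<open>0\<close> by higher ones.
\<close>

lemma eq_at_Suc: "eq_at (Suc i) ((n + int (\<delta> i)) div int p) \<Longrightarrow> eq_at i n"
  unfolding eq_at_letters[of i] by (simp add: eq_at_def)

lemma eq_at_block: "eq_at i (block \<delta> i n) \<Longrightarrow> x n = y n"
proof (induction i)
  case 0
  then show ?case by (simp add: eq_at_0)
next
  case (Suc i)
  then show ?case using eq_at_Suc[of i "block \<delta> i n"] by (simp add: block_Suc)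
qed

text \<open>
  As \<open>\<tau>\<close> is one-to-one, different letters at one level have a descendant at which \<open>x\<close> and \<open>y\<close> differ.
\<close>

lemma not_eq_at_imp_neq: "\<not> eq_at i c \<Longrightarrow> \<exists>n. block \<delta> i n = c \<and> x n \<noteq> y n"
proof (induction i arbitrary: c)
  case 0
  then show ?case by (simp add: eq_at_0)
next
  case (Suc i)
  have "\<tau> (desubst p \<tau> x (Suc i) c) \<noteq> \<tau> (desubst p \<tau> y (Suc i) c)"
    using Suc.prems inj unfolding eq_at_def by (simp add: inj_eq)
  then obtain r where r: "r < p"
    "\<tau> (desubst p \<tau> x (Suc i) c) ! r \<noteq> \<tau> (desubst p \<tau> y (Suc i) c) ! r"
    using nth_equalityI[of "\<tau> (desubst p \<tau> x (Suc i) c)" "\<tau> (desubst p \<tau> y (Suc i) c)"] by auto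
  define d where "d = int r + c * int p - int (\<delta> i)"
  have d: "(d + int (\<delta> i)) div int p = c" "nat ((d + int (\<delta> i)) mod int p) = r"
    using r(1) p_pos by (simp_all add: d_def)
  have "\<not> eq_at i d" unfolding eq_at_letters d by (rule r(2))
  then obtain n where "block \<delta> i n = d" "x n \<noteq> y n" using Suc.IH by blast
  then show ?case using d(1) by (auto simp: block_Suc)
qed

lemma right_part_eq_iff:
  "right_part p \<tau> i x = right_part p \<tau> i y \<longleftrightarrow>
     (\<forall>c. 1 \<le> c \<and> c + int (\<delta> i) < int p \<longrightarrow> eq_at i c)"
  unfolding right_part_def same_digits[symmetric] eq_at_def by (auto simp: map_eq_conv)

lemma infinite_digits: "infinite (I_plus p \<tau> x) \<longleftrightarrow> infinite {i. \<delta> i < p - 1}"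
proof -
  have "I_plus p \<tau> x = {i. \<delta> i < p - 1}" using mem_I_plus[of _ x] by blast
  then show ?thesis by simp
qed

lemma block_eventually_0_pair:
  assumes "infinite (I_plus p \<tau> x)" "0 \<le> n"
  shows "\<exists>I. \<forall>i\<ge>I. block \<delta> i n = 0"
  by (rule block_eventually_0[OF \<delta>_less _ assms(2)]) (use assms(1) infinite_digits in simp)

text \<open>
  Let \<open>n\<close> be beyond the block of index \<open>0\<close> of level \<open>I\<close>.  At the first level at which its block has
  index \<open>0\<close>, the block one level below belongs to the image of \<open>s\<^sub>j\<close> for some \<open>j \<ge> I\<close>; so \<open>x\<^sub>n = y\<^sub>n\<close> if
  \<open>s\<^sub>j(x) = s\<^sub>j(y)\<close>.  Conversely a difference of \<open>s\<^sub>i(x)\<close> and \<open>s\<^sub>i(y)\<close> is seen in a block of positive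
  index, and the blocks of positive index move off to the right as \<open>i\<close> grows.
\<close>

lemma eventually_equal_iff:
  assumes "infinite (I_plus p \<tau> x)"
  shows "eventually_equal x y \<longleftrightarrow> finite {i. right_part p \<tau> i x \<noteq> right_part p \<tau> i y}"
proof
  assume "finite {i. right_part p \<tau> i x \<noteq> right_part p \<tau> i y}"
  then obtain I where I: "\<And>i. right_part p \<tau> i x \<noteq> right_part p \<tau> i y \<Longrightarrow> i < I"
    unfolding finite_nat_set_iff_bounded by blast
  have "x n = y n" if n: "n \<ge> int p ^ I" for n
  proof -
    have n0: "0 \<le> n" using n zero_le_power[of "int p" I] by linarith
    define J where "J = (LEAST i. block \<delta> i n = 0)"
    have "\<exists>i. block \<delta> i n = 0"
      using block_eventually_0_pair[OF assms n0] by auto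
    then have J: "block \<delta> J n = 0" unfolding J_def by (rule LeastI_ex)
    have "block \<delta> I n \<noteq> 0" using block_pos[OF n, of \<delta>] by simp
    then have "\<not> J \<le> I" using block_eq_0_mono[of \<delta> J n I, OF \<delta>_less J] by blast
    then obtain j where j: "J = Suc j" "I \<le> j" by (cases J) auto
    have "block \<delta> j n \<noteq> 0"
      using not_less_Least[of j "\<lambda>i. block \<delta> i n = 0"] j(1) unfolding J_def by simp
    then have "1 \<le> block \<delta> j n" using block_nonneg[OF n0, of \<delta> j] by simp
    moreover have "(block \<delta> j n + int (\<delta> j)) div int p = 0"
      using J by (simp add: j(1) block_Suc)
    then have "block \<delta> j n + int (\<delta> j) < int p"
      using p_pos by (auto simp: zdiv_eq_0_iff)
    moreover have "right_part p \<tau> j x = right_part p \<tau> j y"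
      using I[of j] j(2) by auto
    ultimately have "eq_at j (block \<delta> j n)" unfolding right_part_eq_iff by blast
    then show ?thesis by (rule eq_at_block)
  qed
  then show "eventually_equal x y" unfolding eventually_equal_def by blast
next
  assume "eventually_equal x y"
  then obtain N0 where N0: "\<And>n. n \<ge> N0 \<Longrightarrow> x n = y n" unfolding eventually_equal_def by blast
  define N where "N = max 0 N0"
  have N: "0 \<le> N" "\<And>n. n \<ge> N \<Longrightarrow> x n = y n" using N0 by (simp_all add: N_def)
  obtain I where I: "\<And>i. i \<ge> I \<Longrightarrow> block \<delta> i N = 0"
    using block_eventually_0_pair[OF assms N(1)] by auto
  have "right_part p \<tau> i x = right_part p \<tau> i y" if "i \<ge> I" for i
  proof (rule ccontr)
    assume "right_part p \<tau> i x \<noteq> right_part p \<tau> i y"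
    then obtain c where "1 \<le> c" "\<not> eq_at i c" unfolding right_part_eq_iff by blast
    then obtain n where n: "block \<delta> i n \<ge> 1" "x n \<noteq> y n" using not_eq_at_imp_neq by blast
    then have "n < N" using N(2) not_le by blast
    then show False using block_mono[of n N \<delta> i] I[OF that] n(1) by simp
  qed
  then have "{i. right_part p \<tau> i x \<noteq> right_part p \<tau> i y} \<subseteq> {..<I}"
    using not_le by blast
  then show "finite {i. right_part p \<tau> i x \<noteq> right_part p \<tau> i y}"
    using finite_subset by blast
qed

text \<open>
  The block of index \<open>1\<close> of level \<open>j + 1\<close> has a sub-block of level \<open>j\<close> in common in both points,
  namely the one at the coincidence \<open>r\<close>, whatever the letters are.
  It lies to the right of \<open>0\<close> and has length \<open>p\<^sup>j\<close>.
\<close>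

lemma equal_on_windows_if_coincidence:
  assumes r: "r < p" "\<And>a b. \<tau> a ! r = \<tau> b ! r"
  shows "equal_on_windows x y"
  unfolding equal_on_windows_def
proof (intro allI)
  fix m :: nat and N :: int
  define j where "j = 2 * m + 1 + nat N"
  \<comment> \<open>the index at level \<open>j\<close> of the \<open>r\<close>-th letter in the image of the letter of index \<open>1\<close> at level \<open>j + 1\<close>\<close>
  define d where "d = int r + 1 * int p - int (\<delta> j)"
  have "eq_at j d"
  proof -
    have "(d + int (\<delta> j)) mod int p = int r" using r(1) by (simp add: d_def)
    then show ?thesis unfolding eq_at_letters using r(2) by simp
  qed
  then have eq: "x n = y n" if "block \<delta> j n = d" for n
    using that eq_at_block by blast
  define n where "n = d * int p ^ j - offset \<delta> j + int (m + nat N)"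
  have "j < 2 ^ j" by (rule less_exp)
  also have "(2::nat) ^ j \<le> p ^ j" using p_ge_2 by (intro power_mono) simp_all
  finally have big: "int j < int p ^ j" by (metis of_nat_less_iff of_nat_power)
  have "1 * int p ^ j \<le> d * int p ^ j"
    using \<delta>_less[of j] by (intro mult_right_mono) (simp_all add: d_def)
  then have "N \<le> n"
    unfolding n_def using offset_less[of \<delta> j, OF \<delta>_less] by simp
  moreover have "x (i + n) = y (i + n)" if i: "\<bar>i\<bar> \<le> int m" for i
  proof (rule eq)
    have "block \<delta> j (i + n) = (i + int (m + nat N) + d * int p ^ j) div int p ^ j"
      by (simp add: block_def n_def algebra_simps)
    also have "\<dots> = (i + int (m + nat N)) div int p ^ j + d"
      using p_pos by simp
    also have "(i + int (m + nat N)) div int p ^ j = 0"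
    proof (rule div_pos_pos_trivial)
      have "int j = 2 * int m + 1 + int (nat N)" by (simp add: j_def)
      then show "0 \<le> i + int (m + nat N)" "i + int (m + nat N) < int p ^ j"
        using i big by linarith+
    qed
    finally show "block \<delta> j (i + n) = d" by simp
  qed
  ultimately show "\<exists>n\<ge>N. agree m (translate n x) (translate n y)"
    by (auto simp: agree_def)
qed

text \<open>
  Without coincidences agreement also passes upwards, and \<open>n\<close> and \<open>m\<close> share the block of index \<open>0\<close> of some
  level.
\<close>

lemma all_neq_if_no_coincidence:
  assumes no: "\<And>r a b. r < p \<Longrightarrow> a \<noteq> b \<Longrightarrow> \<tau> a ! r \<noteq> \<tau> b ! r"
    and inf: "infinite (I_plus p \<tau> x)"
    and n: "0 \<le> n" "x n \<noteq> y n" and m: "0 \<le> m"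
  shows "x m \<noteq> y m"
proof -
  have step: "eq_at i k \<longleftrightarrow> eq_at (Suc i) ((k + int (\<delta> i)) div int p)" for i k
  proof -
    have r: "nat ((k + int (\<delta> i)) mod int p) < p" using p_pos by (simp add: nat_less_iff)
    have "\<tau> a ! nat ((k + int (\<delta> i)) mod int p) = \<tau> b ! nat ((k + int (\<delta> i)) mod int p) \<longleftrightarrow> a = b"
      for a b
      using no[OF r, of a b] by auto
    then show ?thesis unfolding eq_at_letters[of i k] eq_at_def[of "Suc i"] .
  qed
  have lift: "x k = y k \<longleftrightarrow> eq_at i (block \<delta> i k)" for i k
  proof (induction i)
    case (Suc i)
    then show ?case using step[of i "block \<delta> i k"] by (simp only: block_Suc)
  qed (simp add: eq_at_0)
  obtain I where I: "\<And>i. i \<ge> I \<Longrightarrow> block \<delta> i n = 0"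
    using block_eventually_0_pair[OF inf n(1)] by auto
  obtain J where J: "\<And>i. i \<ge> J \<Longrightarrow> block \<delta> i m = 0"
    using block_eventually_0_pair[OF inf m] by auto
  have bn: "block \<delta> (max I J) n = 0" and bm: "block \<delta> (max I J) m = 0"
    by (rule I, rule max.cobounded1) (rule J, rule max.cobounded2)
  show ?thesis
    using lift[of n "max I J"] lift[of m "max I J"] n(2) unfolding bn bm by blast
qed

text \<open>
  The words \<open>s\<^sub>i\<close> differ for at most one \<open>i\<close>.  If they differ, the letters of level \<open>i + 1\<close> at \<open>0\<close>
  differ and the only position \<open>r0\<close> at which their images differ lies in \<open>s\<^sub>i\<close>, so \<open>\<delta>\<^sub>i \<noteq> r0\<close>.  From then on
  the letters at \<open>0\<close> differ at all levels \<open>k > i\<close>, which forces \<open>\<delta>\<^sub>k = r0\<close> and leaves \<open>s\<^sub>k\<close> equal.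
\<close>

lemma finite_if_unique_non_coincidence:
  assumes eq: "\<And>r a b. r < p \<Longrightarrow> r \<noteq> r0 \<Longrightarrow> \<tau> a ! r = \<tau> b ! r"
  shows "finite {i. right_part p \<tau> i x \<noteq> right_part p \<tau> i y}"
proof -
  let ?D = "{i. right_part p \<tau> i x \<noteq> right_part p \<tau> i y}"
  have up: "\<not> eq_at (Suc i) 0 \<and> \<delta> i \<noteq> r0" if "i \<in> ?D" for i
  proof -
    have "right_part p \<tau> i x \<noteq> right_part p \<tau> i y" using that by simp
    then obtain k where k: "1 \<le> k" "k + int (\<delta> i) < int p" "\<not> eq_at i k"
      unfolding right_part_eq_iff by auto
    have div0: "(k + int (\<delta> i)) div int p = 0"
      by (rule div_pos_pos_trivial) (use k in simp_all)
    have mod0: "(k + int (\<delta> i)) mod int p = k + int (\<delta> i)"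
      by (rule mod_pos_pos_trivial) (use k in simp_all)
    have "\<not> eq_at (Suc i) 0" using eq_at_Suc[of i k] k(3) unfolding div0 by blast
    moreover have "\<delta> i \<noteq> r0"
    proof
      assume "\<delta> i = r0"
      moreover have "nat (k + int (\<delta> i)) < p" "nat (k + int (\<delta> i)) \<noteq> \<delta> i"
        using k(1,2) by linarith+
      ultimately have "eq_at i k" unfolding eq_at_letters mod0 by (intro eq) simp_all
      then show False using k(3) by simp
    qed
    ultimately show ?thesis by blast
  qed
  have down: "eq_at i 0" if "eq_at k 0" "i \<le> k" for i k
    using that(2,1)
  proof (induction k rule: dec_induct)
    case (step k)
    have "(0 + int (\<delta> k)) div int p = 0" using \<delta>_less[of k] by simp
    then have "eq_at k 0" using eq_at_Suc[of k 0] step.prems by (simp only:)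
    then show ?case by (rule step.IH)
  qed simp
  have digit: "\<delta> i = r0" if "\<not> eq_at i 0" for i
  proof (rule ccontr)
    assume ne: "\<delta> i \<noteq> r0"
    have "nat ((0 + int (\<delta> i)) mod int p) = \<delta> i" using \<delta>_less[of i] by simp
    then have "eq_at i 0"
      unfolding eq_at_letters by (simp only:) (rule eq[OF \<delta>_less ne])
    then show False using that by blast
  qed
  have le: "i \<le> k" if "k \<in> ?D" "i \<in> ?D" for i k
  proof (rule ccontr)
    assume "\<not> i \<le> k"
    then have "Suc k \<le> i" by simp
    then have "\<not> eq_at i 0" using down[of i "Suc k"] up[OF that(1)] by blast
    then show False using digit[of i] up[OF that(2)] by blast
  qed
  show ?thesis
  proof (cases "?D = {}")
    case False
    then obtain k where "k \<in> ?D" by blast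
    then have "?D \<subseteq> {..k}" using le by blast
    then show ?thesis by (rule finite_subset) simp
  qed (simp only: finite.emptyI)
qed

lemma translate_pair: "same_digits_pair \<tau> p (translate k x) (translate k y)"
  by (intro same_digits_pair.intro aperiodic_substitution_axioms same_digits_pair_axioms.intro
      translate_in_lang_shift x_in y_in digits_translate_cong[OF x_in y_in same_digits])

lemma I_plus_eq: "I_plus p \<tau> x = I_plus p \<tau> y"
  using mem_I_plus[of _ x] mem_I_plus[of _ y] same_digits by auto

lemma k_plus_eq: "k_plus p \<tau> x = k_plus p \<tau> y"
proof -
  have "length (right_word p \<tau> i x) = length (right_word p \<tau> i y)" for i
    using length_right_word[OF x_in, of i] length_right_word[OF y_in, of i] same_digits by simp
  then show ?thesis unfolding k_plus_def I_plus_eq by simp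
qed

lemma eventually_equal_translate:
  "eventually_equal (translate k x) (translate k y) \<longleftrightarrow> eventually_equal x y"
proof
  assume "eventually_equal (translate k x) (translate k y)"
  then obtain N where N: "\<And>n. n \<ge> N \<Longrightarrow> x (n + k) = y (n + k)"
    unfolding eventually_equal_def by auto
  have "x n = y n" if "n \<ge> N + k" for n
    using N[of "n - k"] that by simp
  then show "eventually_equal x y" unfolding eventually_equal_def by blast
next
  assume "eventually_equal x y"
  then obtain N where N: "\<And>n. n \<ge> N \<Longrightarrow> x n = y n"
    unfolding eventually_equal_def by blast
  have "translate k x n = translate k y n" if "n \<ge> N - k" for n
    using N[of "n + k"] that by simp
  then show "eventually_equal (translate k x) (translate k y)"
    unfolding eventually_equal_def by blast
qed

lemma eventually_equal_if_unique_non_coincidence: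
  assumes "\<And>r a b. r < p \<Longrightarrow> r \<noteq> r0 \<Longrightarrow> \<tau> a ! r = \<tau> b ! r"
  shows "eventually_equal x y"
proof -
  obtain k where "infinite (I_plus p \<tau> (translate k x))"
    using ex_translate_infinite_I_plus[OF x_in] by blast
  then have "eventually_equal (translate k x) (translate k y)"
    using same_digits_pair.eventually_equal_iff[OF translate_pair]
      same_digits_pair.finite_if_unique_non_coincidence[OF translate_pair assms] by simp
  then show ?thesis by (simp only: eventually_equal_translate)
qed

lemma not_equal_on_windows_if_no_coincidence:
  assumes no: "\<And>r a b. r < p \<Longrightarrow> a \<noteq> b \<Longrightarrow> \<tau> a ! r \<noteq> \<tau> b ! r"
    and i: "x i \<noteq> y i" "infinite (I_plus p \<tau> (translate i x))"
  shows "\<not> equal_on_windows x y"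
proof
  have neq: "x n \<noteq> y n" if "n \<ge> i" for n
    using same_digits_pair.all_neq_if_no_coincidence[OF translate_pair no i(2), of 0 "n - i"] i(1) that
    by simp
  assume "equal_on_windows x y"
  then obtain n where "n \<ge> i" "agree 0 (translate n x) (translate n y)"
    unfolding equal_on_windows_def by blast
  then show False using neq[of n] by (simp add: agree_def)
qed

lemma eventually_equal_if_equal_where_I_plus_infinite:
  assumes "\<And>i. 0 \<le> i \<Longrightarrow> infinite (I_plus p \<tau> (translate i x)) \<Longrightarrow> x i = y i"
  shows "eventually_equal x y"
proof -
  obtain k where k: "k \<ge> 0" "infinite (I_plus p \<tau> (translate k x))"
    using ex_translate_infinite_I_plus[OF x_in] by blast
  have "x n = y n" if "n \<ge> k" for n
  proof (rule assms)
    have "infinite (I_plus p \<tau> (translate (n - k) (translate k x)))"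
      by (rule infinite_I_plus_translate[OF translate_in_lang_shift[OF x_in] k(2)]) (use that in simp)
    then show "infinite (I_plus p \<tau> (translate n x))" by simp
  qed (use that k(1) in simp)
  then show ?thesis unfolding eventually_equal_def by blast
qed

lemma eventually_equal_iff_right_parts:
  "eventually_equal x y \<longleftrightarrow>
     (if infinite (I_plus p \<tau> x)
      then finite {i. right_part p \<tau> i x \<noteq> right_part p \<tau> i y}
      else finite {i. right_part p \<tau> i ((shift ^^ the_enat (k_plus p \<tau> x)) x)
                    \<noteq> right_part p \<tau> i ((shift ^^ the_enat (k_plus p \<tau> y)) y)})"
proof (cases "infinite (I_plus p \<tau> x)")
  case True
  then show ?thesis using eventually_equal_iff by simp
next
  case False
  then have fin: "finite (I_plus p \<tau> x)" by simp
  obtain k where k: "k_plus p \<tau> x = enat k" "\<And>i. digits p \<tau> (translate (int k) x) i = 0"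
    using k_plus_finite[OF x_in fin] by metis
  have ky: "k_plus p \<tau> y = enat k" using k(1) k_plus_eq by simp
  have "I_plus p \<tau> (translate (int k) x) = UNIV"
    using mem_I_plus p_ge_2 k(2) by auto
  then have "infinite (I_plus p \<tau> (translate (int k) x))" by simp
  from same_digits_pair.eventually_equal_iff[OF translate_pair this]
  show ?thesis
    unfolding k(1) ky the_enat.simps funpow_shift eventually_equal_translate using False by simp
qed

end

section \<open>Construction of a Li-Yorke pair\<close>

context aperiodic_substitution
begin

lemma digits_funpow_prolong:
  assumes "z \<in> lang_shift" "c < p" "i < j"
  shows "digits p \<tau> ((prolong c ^^ j) z) i = c"
proof -
  have mem: "(prolong c ^^ k) z \<in> lang_shift" for k
    by (induction k) (simp_all add: assms(1) prolong_in_lang_shift)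
  have "(parent ^^ i) ((prolong c ^^ (i + k)) z) = (prolong c ^^ k) z" for k
  proof (induction i)
    case (Suc i)
    have "(parent ^^ Suc i) ((prolong c ^^ (Suc i + k)) z)
        = (parent ^^ i) (parent (prolong c ((prolong c ^^ (i + k)) z)))"
      unfolding funpow_Suc_right by simp
    also have "\<dots> = (prolong c ^^ k) z"
      unfolding parent_prolong[OF mem assms(2)] by (rule Suc.IH)
    finally show ?case .
  qed simp
  from this[of "j - i"] have "(parent ^^ i) ((prolong c ^^ j) z) = (prolong c ^^ (j - i)) z"
    using assms(3) by simp
  also have "\<dots> = prolong c ((prolong c ^^ (j - i - 1)) z)"
    using assms(3) by (cases "j - i") simp_all
  finally show ?thesis
    using phase_prolong[OF mem assms(2)] by (simp add: digits_eq[OF mem])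
qed

text \<open>
  Apply \<open>T\<^sup>c \<tau>\<close> again and again to two points with different letters at \<open>0\<close>.  These letters stay different, as
  \<open>c\<close> is a non-coincidence, and a cluster point of the pairs lies in the image of all iterates of
  \<open>T\<^sup>c \<tau>\<close>, so all digits are \<open>c\<close>.
\<close>

lemma ex_pair_with_constant_digits:
  assumes c: "c < p" "\<And>a b. a \<noteq> b \<Longrightarrow> \<tau> a ! c \<noteq> \<tau> b ! c"
  obtains x y where "x \<in> lang_shift" "y \<in> lang_shift" "x 0 \<noteq> y 0"
    "digits p \<tau> x = (\<lambda>_. c)" "digits p \<tau> y = (\<lambda>_. c)"
proof -
  obtain z' w' where zw': "z' \<in> lang_shift" "w' \<in> lang_shift" "z' \<noteq> w'"
    using infinite_lang_shift by (metis finite.emptyI finite_insert finite_subset insertCI subsetI)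
  then obtain n where "z' n \<noteq> w' n" by blast
  define z w where "z = translate n z'" and "w = translate n w'"
  have zw: "z \<in> lang_shift" "w \<in> lang_shift" "z 0 \<noteq> w 0"
    unfolding z_def w_def using zw' \<open>z' n \<noteq> w' n\<close> by (simp_all add: translate_in_lang_shift)
  have zero: "prolong c v 0 = \<tau> (v 0) ! c" for v
    using c(1) by (simp add: prolong_apply)
  have neq: "(prolong c ^^ k) z 0 \<noteq> (prolong c ^^ k) w 0" for k
    by (induction k) (simp_all add: zw(3) zero c(2))
  \<comment> \<open>a cluster point over the product alphabet treats both sequences along the same indices\<close>
  define P where "P k = (\<lambda>i. ((prolong c ^^ k) z i, (prolong c ^^ k) w i))" for k
  obtain Q where Q: "\<And>m N. \<exists>k\<ge>N. agree m Q (P k)"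
    using ex_cluster_point[of P] by metis
  define x y where "x = fst \<circ> Q" and "y = snd \<circ> Q"
  have xy: "\<exists>k\<ge>N. agree m x ((prolong c ^^ k) z) \<and> agree m y ((prolong c ^^ k) w)" for m N
  proof -
    obtain k where "k \<ge> N" "agree m Q (P k)" using Q by blast
    then show ?thesis by (intro exI[of _ k]) (simp add: agree_def x_def y_def P_def)
  qed
  have closed: "closedin full_shift_topology ((prolong c ^^ j) ` lang_shift)" for j
  proof (induction j)
    case (Suc j)
    have "(prolong c ^^ Suc j) ` lang_shift = prolong c ` ((prolong c ^^ j) ` lang_shift)"
      by (simp add: image_comp)
    then show ?case using closedin_prolong_image[OF Suc.IH c(1)] by simp
  qed (simp add: closedin_lang_shift)
  have mem: "(prolong c ^^ k) v \<in> (prolong c ^^ j) ` lang_shift"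
    if "v \<in> lang_shift" "j \<le> k" for v k j
  proof -
    have "(prolong c ^^ i) v \<in> lang_shift" for i
      by (induction i) (simp_all add: that(1) prolong_in_lang_shift)
    moreover have "(prolong c ^^ k) v = (prolong c ^^ j) ((prolong c ^^ (k - j)) v)"
      using funpow_add[of j "k - j" "prolong c"] that(2) by simp
    ultimately show ?thesis by blast
  qed
  have x: "x \<in> (prolong c ^^ j) ` lang_shift" for j
    by (rule closedin_full_shiftD[OF closed]) (use xy[of j] mem[OF zw(1)] in blast)
  have y: "y \<in> (prolong c ^^ j) ` lang_shift" for j
    by (rule closedin_full_shiftD[OF closed]) (use xy[of j] mem[OF zw(2)] in blast)
  have "digits p \<tau> x i = c" "digits p \<tau> y i = c" for i
  proof -
    obtain u v where "u \<in> lang_shift" "x = (prolong c ^^ Suc i) u"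
      "v \<in> lang_shift" "y = (prolong c ^^ Suc i) v"
      using x[of "Suc i"] y[of "Suc i"] by (metis imageE)
    then show "digits p \<tau> x i = c" "digits p \<tau> y i = c"
      using digits_funpow_prolong[OF _ c(1), of _ i "Suc i"] by simp_all
  qed
  moreover have "x 0 \<noteq> y 0"
  proof -
    obtain k where "agree 0 x ((prolong c ^^ k) z)" "agree 0 y ((prolong c ^^ k) w)"
      using xy by blast
    then have "x 0 = (prolong c ^^ k) z 0" "y 0 = (prolong c ^^ k) w 0"
      by (simp_all add: agree_def)
    then show ?thesis using neq[of k] by simp
  qed
  ultimately show ?thesis using that[of x y] x[of 0] y[of 0] by (simp add: fun_eq_iff)
qed

text \<open>
  Since \<open>c' > c\<close> lies to the right of the digit \<open>c\<close>, it is a position of \<open>s\<^sub>i\<close> for each \<open>i\<close>, and both points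
  differ there because their letters at \<open>0\<close> differ at all levels.
\<close>

lemma ex_proximal_not_eventually_equal:
  assumes r: "r < p" "\<And>a b. \<tau> a ! r = \<tau> b ! r"
    and c: "c < c'" "c' < p" "\<And>a b. a \<noteq> b \<Longrightarrow> \<tau> a ! c \<noteq> \<tau> b ! c"
      "\<And>a b. a \<noteq> b \<Longrightarrow> \<tau> a ! c' \<noteq> \<tau> b ! c'"
  obtains x y where "x \<in> lang_shift" "y \<in> lang_shift" "equal_on_windows x y" "\<not> eventually_equal x y"
proof -
  have cp: "c < p" using c(1,2) by simp
  obtain x y where xy: "x \<in> lang_shift" "y \<in> lang_shift" "x 0 \<noteq> y 0"
    "digits p \<tau> x = (\<lambda>_. c)" "digits p \<tau> y = (\<lambda>_. c)"
    by (rule ex_pair_with_constant_digits[OF cp c(3)])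
  interpret P: same_digits_pair \<tau> p x y
    by unfold_locales (use xy in simp_all)
  have neq: "\<not> P.eq_at i 0" for i
  proof (induction i)
    case 0
    then show ?case by (simp add: P.eq_at_0 xy(3))
  next
    case (Suc i)
    have "(0 + int (digits p \<tau> x i)) div int p = 0" using cp by (simp add: xy(4))
    then show ?case using P.eq_at_Suc[of i 0] Suc.IH by metis
  qed
  have "right_part p \<tau> i x \<noteq> right_part p \<tau> i y" for i
  proof -
    have "(int (c' - c) + int (digits p \<tau> x i)) div int p = 0"
      "nat ((int (c' - c) + int (digits p \<tau> x i)) mod int p) = c'"
      using c(1,2) by (simp_all add: xy(4) of_nat_diff)
    then have "\<not> P.eq_at i (int (c' - c))"
      unfolding P.eq_at_letters using neq[of "Suc i"] c(4) by (simp add: P.eq_at_def)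
    moreover have "1 \<le> int (c' - c)" "int (c' - c) + int (digits p \<tau> x i) < int p"
      using c(1,2) by (simp_all add: xy(4))
    ultimately show ?thesis unfolding P.right_part_eq_iff by blast
  qed
  moreover have "I_plus p \<tau> x = UNIV"
    using mem_I_plus[of _ x] c(1,2) by (auto simp: xy(4))
  ultimately have "\<not> eventually_equal x y"
    using P.eventually_equal_iff by simp
  then show ?thesis using that xy(1,2) P.equal_on_windows_if_coincidence[OF r] by blast
qed

end

theorem corollary3p12:
  fixes \<tau> :: "bool \<Rightarrow> bool list" and p :: nat
    and \<rho> :: "bool biseq \<Rightarrow> bool biseq \<Rightarrow> real"
    and x y :: "bool biseq"
  assumes "substitution \<tau>"
    and "inj \<tau>"
    and "primitive_subst \<tau>"
    and "p \<ge> 2"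
    and "constant_length \<tau> p"
    and "infinite (subst_shift \<tau>)"
    and "compatible_metric (subst_shift \<tau>) \<rho>"
    and "x \<in> subst_shift \<tau>" and "y \<in> subst_shift \<tau>"
    and "digits p \<tau> x = digits p \<tau> y"
  defines "C \<equiv> coincidences (\<tau> False) (\<tau> True)"
    and "N \<equiv> non_coincidences (\<tau> False) (\<tau> True)"
  shows
    "(C = {} \<longrightarrow>
        (if \<exists>i::nat. x (int i) \<noteq> y (int i) \<and>
              infinite (I_plus p \<tau> ((shift ^^ i) x)) \<and> infinite (I_plus p \<tau> ((shift ^^ i) y))
         then distal_pair \<rho> x y
         else asymptotic_pair \<rho> x y))
     \<and>
     ((\<exists>!i. i \<in> N) \<longrightarrow> asymptotic_pair \<rho> x y)
     \<and>
     ((\<exists>x'\<in>subst_shift \<tau>. \<exists>y'\<in>subst_shift \<tau>. li_yorke_pair \<rho> x' y')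
        \<longleftrightarrow> C \<noteq> {} \<and> card N \<ge> 2)
     \<and>
     (C \<noteq> {} \<longrightarrow>
        (li_yorke_pair \<rho> x y \<longleftrightarrow>
          (if infinite (I_plus p \<tau> x)
           then infinite {i. right_part p \<tau> i x \<noteq> right_part p \<tau> i y}
           else infinite {i. right_part p \<tau> i ((shift ^^ the_enat (k_plus p \<tau> x)) x)
                           \<noteq> right_part p \<tau> i ((shift ^^ the_enat (k_plus p \<tau> y)) y)})))"
proof -
  interpret A: aperiodic_substitution \<tau> p
    by unfold_locales (use assms(2-6) in simp_all)
  have X: "subst_shift \<tau> = A.lang_shift" by (rule A.subst_shift_eq)
  interpret M: subshift_metric A.lang_shift \<rho>
    by unfold_locales (use assms(7) A.subshift_lang_shift in \<open>simp_all only: X\<close>)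
  interpret P: same_digits_pair \<tau> p x y
    by unfold_locales (use assms(8-10) in \<open>simp_all only: X\<close>)
  have LY: "li_yorke_pair \<rho> u v \<longleftrightarrow> equal_on_windows u v \<and> \<not> eventually_equal u v"
    if "u \<in> A.lang_shift" "v \<in> A.lang_shift" for u v
    unfolding li_yorke_pair_def
    using M.proximal_pair_iff[OF that] M.asymptotic_pair_iff[OF that] by simp
  \<comment> \<open>with two letters, one comparison of \<open>\<tau>(0)\<close> and \<open>\<tau>(1)\<close> decides all pairs of letters\<close>
  have coinc: "r < p \<and> (\<forall>a b. \<tau> a ! r = \<tau> b ! r)" if "r \<in> C" for r
  proof -
    have r: "r < p" "\<tau> False ! r = \<tau> True ! r" using that by (simp_all add: C_def coincidences_def)
    have "\<tau> a ! r = \<tau> b ! r" for a b using r(2) by (cases a; cases b) simp_all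
    then show ?thesis using r(1) by blast
  qed
  have C_or_N: "r \<in> C \<longleftrightarrow> r \<notin> N" if "r < p" for r
    using that by (simp add: C_def N_def coincidences_def non_coincidences_def)
  have noncoinc: "\<tau> a ! r \<noteq> \<tau> b ! r" if "r \<in> N" "a \<noteq> b" for r a b
  proof -
    have "\<tau> False ! r \<noteq> \<tau> True ! r" using that(1) by (simp add: N_def non_coincidences_def)
    then show ?thesis using that(2) by (cases a; cases b) simp_all
  qed
  have N_less: "r < p" if "r \<in> N" for r
    using that by (simp add: N_def non_coincidences_def)
  have finN: "finite N" by (rule finite_subset[of _ "{..<p}"]) (use N_less in auto)
  have all_N: "\<tau> a ! r \<noteq> \<tau> b ! r" if "C = {}" "r < p" "a \<noteq> b" for r a b
    using noncoinc[OF _ that(3)] C_or_N[OF that(2)] that(1) by blast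
  have single: "\<tau> a ! r = \<tau> b ! r" if "N \<subseteq> {r0}" "r < p" "r \<noteq> r0" for r r0 a b
    using coinc[of r] C_or_N[OF that(2)] that by blast
  have N_ne: "N \<noteq> {}"
  proof
    assume "N = {}"
    then have "\<tau> False ! r = \<tau> True ! r" if "r < p" for r
      using coinc[of r] C_or_N[OF that] by blast
    then have "\<tau> False = \<tau> True" by (intro nth_equalityI) simp_all
    then show False using assms(2) by (simp add: inj_eq)
  qed
  have distal: "distal_pair \<rho> x y"
    if "C = {}" "x (int i) \<noteq> y (int i)" "infinite (I_plus p \<tau> ((shift ^^ i) x))" for i
    using P.not_equal_on_windows_if_no_coincidence[OF all_N[OF that(1)] that(2)] that(3)
      M.distal_pair_iff[OF P.x_in P.y_in]
    by (simp add: funpow_shift)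
  have part1: "if \<exists>i::nat. x (int i) \<noteq> y (int i) \<and>
      infinite (I_plus p \<tau> ((shift ^^ i) x)) \<and> infinite (I_plus p \<tau> ((shift ^^ i) y))
    then distal_pair \<rho> x y else asymptotic_pair \<rho> x y" if C: "C = {}"
  proof (cases "\<exists>i::nat. x (int i) \<noteq> y (int i) \<and>
      infinite (I_plus p \<tau> ((shift ^^ i) x)) \<and> infinite (I_plus p \<tau> ((shift ^^ i) y))")
    case True
    then show ?thesis using distal[OF C] by auto
  next
    case False
    have "eventually_equal x y"
    proof (rule P.eventually_equal_if_equal_where_I_plus_infinite)
      fix i :: int
      assume i: "0 \<le> i" "infinite (I_plus p \<tau> (translate i x))"
      have "I_plus p \<tau> (translate i y) = I_plus p \<tau> (translate i x)"
        by (rule same_digits_pair.I_plus_eq[OF P.translate_pair, symmetric])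
      moreover have "translate i z = (shift ^^ nat i) z" for z :: "bool biseq"
        using i(1) by (simp add: funpow_shift)
      ultimately show "x i = y i"
        using False i by (metis int_nat_eq)
    qed
    then have "asymptotic_pair \<rho> x y" using M.asymptotic_pair_iff[OF P.x_in P.y_in] by blast
    then show ?thesis unfolding if_not_P[OF False] .
  qed
  have part2: "asymptotic_pair \<rho> x y" if ex1: "\<exists>!i. i \<in> N"
  proof -
    obtain r0 where "N \<subseteq> {r0}" using ex1 by blast
    then have "eventually_equal x y"
      using P.eventually_equal_if_unique_non_coincidence[of r0] single by blast
    then show ?thesis using M.asymptotic_pair_iff[OF P.x_in P.y_in] by blast
  qed
  have part3: "(\<exists>x'\<in>A.lang_shift. \<exists>y'\<in>A.lang_shift. li_yorke_pair \<rho> x' y') \<longleftrightarrow> C \<noteq> {} \<and> card N \<ge> 2"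
  proof
    assume "\<exists>x'\<in>A.lang_shift. \<exists>y'\<in>A.lang_shift. li_yorke_pair \<rho> x' y'"
    then obtain u v where uv: "u \<in> A.lang_shift" "v \<in> A.lang_shift"
      "equal_on_windows u v" "\<not> eventually_equal u v"
      using LY by blast
    \<comment> \<open>being proximal, \<open>u\<close> and \<open>v\<close> have the same digits, so the results for such pairs apply\<close>
    interpret Q: same_digits_pair \<tau> p u v
      by unfold_locales (use uv A.equal_on_windows_digits in simp_all)
    have "C \<noteq> {}"
    proof
      assume C: "C = {}"
      have "eventually_equal u v"
        by (rule Q.eventually_equal_if_equal_where_I_plus_infinite)
          (use Q.not_equal_on_windows_if_no_coincidence[OF all_N[OF C]] uv(3) in blast)
      then show False using uv(4) by blast
    qed
    moreover have "card N \<ge> 2"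
    proof (rule ccontr)
      assume "\<not> card N \<ge> 2"
      moreover have "card N > 0" using N_ne finN by (simp add: card_gt_0_iff)
      ultimately have "card N = 1" by linarith
      then obtain r0 where "N \<subseteq> {r0}" by (auto simp: card_1_singleton_iff)
      then have "eventually_equal u v"
        using Q.eventually_equal_if_unique_non_coincidence[of r0] single by blast
      then show False using uv(4) by blast
    qed
    ultimately show "C \<noteq> {} \<and> card N \<ge> 2" by blast
  next
    assume CN: "C \<noteq> {} \<and> card N \<ge> 2"
    then obtain r where r: "r \<in> C" by blast
    \<comment> \<open>the constant digit is the first non-coincidence, which leaves another one to its right\<close>
    have "\<not> N \<subseteq> {Min N}"
      using CN card_mono[of "{Min N}" N] by auto
    then obtain c' where c': "c' \<in> N" "c' \<noteq> Min N" by blast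
    have c: "Min N \<in> N" by (rule Min_in[OF finN N_ne])
    have c_less: "Min N < c'"
      using Min_le[OF finN c'(1)] c'(2) by linarith
    obtain u v where "u \<in> A.lang_shift" "v \<in> A.lang_shift"
      "equal_on_windows u v" "\<not> eventually_equal u v"
      by (rule A.ex_proximal_not_eventually_equal[of r "Min N" c'])
        (use coinc[OF r] c c_less c'(1) N_less noncoinc in blast)+
    then show "\<exists>x'\<in>A.lang_shift. \<exists>y'\<in>A.lang_shift. li_yorke_pair \<rho> x' y'"
      using LY by blast
  qed
  have part4: "li_yorke_pair \<rho> x y \<longleftrightarrow>
      (if infinite (I_plus p \<tau> x)
       then infinite {i. right_part p \<tau> i x \<noteq> right_part p \<tau> i y}
       else infinite {i. right_part p \<tau> i ((shift ^^ the_enat (k_plus p \<tau> x)) x)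
                       \<noteq> right_part p \<tau> i ((shift ^^ the_enat (k_plus p \<tau> y)) y)})"
    if C: "C \<noteq> {}"
  proof -
    obtain r where "r \<in> C" using C by blast
    then have "equal_on_windows x y"
      using coinc[of r] by (intro P.equal_on_windows_if_coincidence[of r]) blast+
    then have "li_yorke_pair \<rho> x y \<longleftrightarrow> \<not> eventually_equal x y"
      using LY[OF P.x_in P.y_in] by blast
    then show ?thesis
      unfolding P.eventually_equal_iff_right_parts by (simp split: if_split)
  qed
  show ?thesis
    unfolding X using part1 part2 part3 part4 by blast
qed

end
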